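(* Let $n\ge 2$ be an integer, let $L$ be an origin-symmetric convex body in $\mathbb{R}^n$, and let $\mu$ be a measure on $L$ with even continuous non-negative density $g: L\to[0,\infty)$. Then $$\mu(L)\ \le\ \sqrt{n}\,\frac{n}{n-1}\, c_n\,\max_{\xi\in S^{n-1}} \mu(L\cap \xi^\perp)\ |L|^{1/n},$$ where $c_n=\dfrac{|B_2^n|^{\frac{n-1}{n}}}{|B_2^{n-1}|}$.
   Context: A convex body in $\mathbb{R}^n$ is a compact convex set with non-empty interior; it is origin-symmetric if $L=-L$. $S^{n-1}$ is the Euclidean unit sphere in $\mathbb{R}^n$, and for $\xi\in S^{n-1}$, $\xi^\perp=\{x\in\mathbb{R}^n: \langle x,\xi\rangle=0\}$ is the central hyperplane perpendicular to $\xi$. $|\cdot|$ denotes volume (Lebesgue measure) of the appropriate dimension. $B_2^k$ is the unit Euclidean ball in $\mathbb{R}^k$, with $|B_2^k|=\pi^{k/2}/\Gamma(1+k/2)$. A function $g$ on $L$ is even if $g(-x)=g(x)$ for all $x\in L$. For the measure $\mu$ with density $g$: $\mu(L)=\int_L g(x)\,dx$ (with respect to $n$-dimensional Lebesgue measure), and $\mu(L\cap\xi^\perp)=\int_{L\cap\xi^\perp} g(x)\,dx$, where the integral is with respect to $(n-1)$-dimensional Lebesgue measure on the hyperplane $\xi^\perp$. *)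

theory Defs
  imports "HOL-Analysis.Analysis"
begin

definition origin_symmetric_convex_body :: "'a::euclidean_space set \<Rightarrow> bool" where
  "origin_symmetric_convex_body L \<longleftrightarrow>
     compact L \<and> convex L \<and> interior L \<noteq> {} \<and> uminus ` L = L"

definition orthonormal_basis_of :: "'a::euclidean_space set \<Rightarrow> 'a set \<Rightarrow> bool" where
  "orthonormal_basis_of S B \<longleftrightarrow> pairwise orthogonal B \<and> (\<forall>b\<in>B. norm b = 1) \<and> span B = S"

definition coords_to_vec :: "'a::euclidean_space set \<Rightarrow> ('a \<Rightarrow> real) \<Rightarrow> 'a" where
  "coords_to_vec B f = (\<Sum>b\<in>B. f b *\<^sub>R b)"

text \<open>Lebesgue (Borel) measure of dimension \<open>dim S\<close> on a linear subspace \<open>S\<close>, viewed as a Borel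
  measure on the ambient space that is concentrated on \<open>S\<close>: the image of the product Lebesgue
  measure under an orthonormal coordinate system of \<open>S\<close>.  This follows the library's definition of
  \<open>lborel\<close>, with the standard basis replaced by an orthonormal basis of \<open>S\<close>; the choice of that
  basis is irrelevant by \<open>lborel_subspace_eq\<close> below.\<close>

definition lborel_subspace :: "'a::euclidean_space set \<Rightarrow> 'a measure" where
  "lborel_subspace S =
     (let B = (SOME B. orthonormal_basis_of S B)
      in distr (\<Pi>\<^sub>M b\<in>B. lborel) borel (coords_to_vec B))"

abbreviation hyperplane_perp :: "'a::euclidean_space \<Rightarrow> 'a set" where
  "hyperplane_perp \<xi> \<equiv> {x. x \<bullet> \<xi> = 0}"

text \<open>The measure with density \<open>g\<close> on \<open>L\<close>, evaluated on all of \<open>L\<close>, and on the central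
  section of \<open>L\<close> by the hyperplane perpendicular to \<open>\<xi>\<close>.\<close>

definition body_mass :: "('a::euclidean_space \<Rightarrow> real) \<Rightarrow> 'a set \<Rightarrow> real" where
  "body_mass g L = (LINT x:L|lborel. g x)"

definition section_mass :: "('a::euclidean_space \<Rightarrow> real) \<Rightarrow> 'a set \<Rightarrow> 'a \<Rightarrow> real" where
  "section_mass g L \<xi> =
     (LINT x:(L \<inter> hyperplane_perp \<xi>)|lborel_subspace (hyperplane_perp \<xi>). g x)"

definition ball_ratio :: "nat \<Rightarrow> real" where
  "ball_ratio n = unit_ball_vol (real n) powr ((real n - 1) / real n) / unit_ball_vol (real n - 1)"


subsection \<open>Independence of the orthonormal basis\<close>

lemma orthonormal_basis_of_exists:
  assumes "subspace S"
  shows "\<exists>B. orthonormal_basis_of S B"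
  using orthonormal_basis_subspace[OF assms] unfolding orthonormal_basis_of_def by metis

lemma orthonormal_basis_ofD:
  assumes "orthonormal_basis_of S B"
  shows "finite B" "card B = dim S" "span B = S"
proof -
  have "0 \<notin> B"
    using assms by (force simp: orthonormal_basis_of_def)
  then have "independent B"
    using assms pairwise_orthogonal_independent[of B] by (auto simp: orthonormal_basis_of_def)
  then show "finite B" "card B = dim S" "span B = S"
    using assms dim_span_eq_card_independent[of B]
    by (auto simp: orthonormal_basis_of_def independent_imp_finite)
qed

lemma coords_to_vec_measurable [measurable]:
  "coords_to_vec B \<in> borel_measurable (\<Pi>\<^sub>M b\<in>B. lborel)"
  unfolding coords_to_vec_def by measurable

lemma coords_to_vec_in_span: "coords_to_vec B f \<in> span B"
  unfolding coords_to_vec_def by (intro span_sum span_scale span_base)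

lemma PiM_lborel_shift:
  fixes c :: "'i \<Rightarrow> real"
  assumes "finite B"
  shows "distr (\<Pi>\<^sub>M b\<in>B. lborel) (\<Pi>\<^sub>M b\<in>B. lborel) (\<lambda>f. \<lambda>b\<in>B. c b + f b) = (\<Pi>\<^sub>M b\<in>B. lborel)"
    (is "distr ?P ?P ?t = ?P")
proof -
  interpret product_sigma_finite "\<lambda>_::'i. lborel :: real measure" ..
  show ?thesis
  proof (rule PiM_eqI[OF assms])
    fix A :: "'i \<Rightarrow> real set" assume A: "\<And>i. i \<in> B \<Longrightarrow> A i \<in> sets lborel"
    have A': "(+) (c i) -` A i \<in> sets lborel" if "i \<in> B" for i
      using measurable_sets[of "(+) (c i)" borel borel "A i"] A[OF that] by simp
    have "emeasure (distr ?P ?P ?t) (Pi\<^sub>E B A) = emeasure ?P (?t -` Pi\<^sub>E B A \<inter> space ?P)"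
      using A assms by (intro emeasure_distr) (auto intro!: sets_PiM_I_finite)
    also have "?t -` Pi\<^sub>E B A \<inter> space ?P = (\<Pi>\<^sub>E i\<in>B. (+) (c i) -` A i)"
      by (auto simp: space_PiM PiE_iff)
    also have "emeasure ?P \<dots> = (\<Prod>i\<in>B. emeasure lborel ((+) (c i) -` A i))"
      using A' assms by (intro emeasure_PiM) auto
    also have "\<dots> = (\<Prod>i\<in>B. emeasure lborel (A i))"
    proof (rule prod.cong)
      fix i assume "i \<in> B"
      have "emeasure (distr lborel borel ((+) (c i))) (A i) = emeasure lborel ((+) (c i) -` A i)"
        using A[OF \<open>i \<in> B\<close>] by (subst emeasure_distr) auto
      then show "emeasure lborel ((+) (c i) -` A i) = emeasure lborel (A i)"
        by (simp add: lborel_distr_plus)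
    qed simp
    finally show "emeasure (distr ?P ?P ?t) (Pi\<^sub>E B A) = (\<Prod>i\<in>B. emeasure lborel (A i))" .
  qed simp
qed

lemma nn_integral_coords_shift:
  assumes B: "finite B" and v: "v \<in> span B" and [measurable]: "h \<in> borel_measurable borel"
  shows "(\<integral>\<^sup>+f. h (v + coords_to_vec B f) \<partial>(\<Pi>\<^sub>M b\<in>B. lborel))
       = (\<integral>\<^sup>+f. h (coords_to_vec B f) \<partial>(\<Pi>\<^sub>M b\<in>B. lborel))"
proof -
  obtain c where c: "v = (\<Sum>b\<in>B. c b *\<^sub>R b)"
    using v span_finite[OF B] by auto
  let ?P = "\<Pi>\<^sub>M b\<in>B. lborel :: real measure" and ?t = "\<lambda>f. \<lambda>b\<in>B. c b + f b"
  have "(\<integral>\<^sup>+f. h (coords_to_vec B f) \<partial>?P) = (\<integral>\<^sup>+f. h (coords_to_vec B f) \<partial>distr ?P ?P ?t)"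
    by (simp only: PiM_lborel_shift[OF B])
  also have "\<dots> = (\<integral>\<^sup>+f. h (coords_to_vec B (?t f)) \<partial>?P)"
    by (subst nn_integral_distr) auto
  also have "\<dots> = (\<integral>\<^sup>+f. h (v + coords_to_vec B f) \<partial>?P)"
    by (simp add: coords_to_vec_def c scaleR_add_left sum.distrib)
  finally show ?thesis by simp
qed

lemma emeasure_coords_cball:
  assumes "orthonormal_basis_of S B"
  shows "(\<integral>\<^sup>+f. indicator (cball 0 1) (coords_to_vec B f) \<partial>(\<Pi>\<^sub>M b\<in>B. lborel))
       = ennreal (unit_ball_vol (real (dim S)))"
proof -
  note B = orthonormal_basis_ofD[OF assms]
  have "norm (coords_to_vec B f) ^ 2 = (\<Sum>b\<in>B. (f b)\<^sup>2)" for f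
  proof -
    have "pairwise (\<lambda>a b. orthogonal (f a *\<^sub>R a) (f b *\<^sub>R b)) B"
      using assms by (auto simp: orthonormal_basis_of_def pairwise_def orthogonal_def)
    then show ?thesis
      using assms unfolding coords_to_vec_def
      by (subst norm_sum_Pythagorean[OF B(1)])
         (auto simp: orthonormal_basis_of_def power_mult_distrib intro!: sum.cong)
  qed
  then have *: "norm (coords_to_vec B f) = sqrt (\<Sum>b\<in>B. (f b)\<^sup>2)" for f
    by (metis norm_ge_zero real_sqrt_abs abs_of_nonneg)
  let ?P = "\<Pi>\<^sub>M b\<in>B. lborel :: real measure"
  have "(\<integral>\<^sup>+f. indicator (cball 0 1) (coords_to_vec B f) \<partial>?P)
      = (\<integral>\<^sup>+f. indicator ({f. sqrt (\<Sum>b\<in>B. (f b)\<^sup>2) \<le> 1} \<inter> space ?P) f \<partial>?P)"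
    by (intro nn_integral_cong) (auto simp: indicator_def *)
  also have "\<dots> = emeasure ?P ({f. sqrt (\<Sum>b\<in>B. (f b)\<^sup>2) \<le> 1} \<inter> space ?P)"
    by (rule nn_integral_indicator) measurable
  also have "\<dots> = ennreal (unit_ball_vol (real (card B)) * 1 ^ card B)"
    using B by (intro emeasure_cball_aux) auto
  finally show ?thesis by (simp add: B)
qed

lemma distr_coords_unique:
  assumes "orthonormal_basis_of S B" "orthonormal_basis_of S C"
  shows "distr (\<Pi>\<^sub>M b\<in>B. lborel) borel (coords_to_vec B)
       = distr (\<Pi>\<^sub>M b\<in>C. lborel) borel (coords_to_vec C)"
proof (rule measure_eqI)
  note B = orthonormal_basis_ofD[OF assms(1)] and C = orthonormal_basis_ofD[OF assms(2)]
  let ?P = "\<Pi>\<^sub>M b\<in>B. lborel :: real measure" and ?Q = "\<Pi>\<^sub>M b\<in>C. lborel :: real measure"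
  let ?p = "coords_to_vec B" and ?q = "coords_to_vec C"
  let ?D = "cball 0 1 :: 'a set" and ?u = "ennreal (unit_ball_vol (real (dim S)))"
  interpret product_sigma_finite "\<lambda>_::'a. lborel :: real measure" ..
  interpret P: sigma_finite_measure ?P by (rule sigma_finite) (rule B)
  interpret Q: sigma_finite_measure ?Q by (rule sigma_finite) (rule C)
  interpret pair_sigma_finite ?P ?Q ..
  have p: "?p f \<in> span C" and q: "?q g \<in> span B" for f g
    using coords_to_vec_in_span[of B f] coords_to_vec_in_span[of C g] B C by auto
  fix A assume "A \<in> sets (distr ?P borel ?p)"
  then have A [measurable]: "A \<in> sets borel" by simp
  have [measurable]: "?D \<in> sets borel" by simp
  let ?a = "indicator A :: 'a \<Rightarrow> ennreal" and ?d = "indicator ?D :: 'a \<Rightarrow> ennreal"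
  have "(\<integral>\<^sup>+f. ?a (?p f) \<partial>?P) * ?u = (\<integral>\<^sup>+g. (\<integral>\<^sup>+f. ?a (?p f) \<partial>?P) * ?d (?q g) \<partial>?Q)"
    unfolding emeasure_coords_cball[OF assms(2), symmetric]
    by (rule nn_integral_cmult[symmetric]) measurable
  also have "\<dots> = (\<integral>\<^sup>+g. (\<integral>\<^sup>+f. ?a (?q g + ?p f) * ?d (?q g) \<partial>?P) \<partial>?Q)"
  proof (rule nn_integral_cong)
    fix g
    have "(\<integral>\<^sup>+f. ?a (?q g + ?p f) * ?d (?q g) \<partial>?P) = (\<integral>\<^sup>+f. ?a (?q g + ?p f) \<partial>?P) * ?d (?q g)"
      by (rule nn_integral_multc) measurable
    then show "(\<integral>\<^sup>+f. ?a (?p f) \<partial>?P) * ?d (?q g) = (\<integral>\<^sup>+f. ?a (?q g + ?p f) * ?d (?q g) \<partial>?P)"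
      using nn_integral_coords_shift[OF B(1) q, of ?a] by simp
  qed
  also have "\<dots> = (\<integral>\<^sup>+f. (\<integral>\<^sup>+g. ?a (?q g + ?p f) * ?d (?q g) \<partial>?Q) \<partial>?P)"
    by (rule Fubini') measurable
  also have "\<dots> = (\<integral>\<^sup>+f. (\<integral>\<^sup>+g. ?a (?q g) * ?d (- ?p f + ?q g) \<partial>?Q) \<partial>?P)"
  proof (rule nn_integral_cong)
    fix f
    show "(\<integral>\<^sup>+g. ?a (?q g + ?p f) * ?d (?q g) \<partial>?Q)
        = (\<integral>\<^sup>+g. ?a (?q g) * ?d (- ?p f + ?q g) \<partial>?Q)"
      using nn_integral_coords_shift[OF C(1) p, of "\<lambda>y. ?a y * ?d (- ?p f + y)" f]
      by (simp add: add.commute)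
  qed
  also have "\<dots> = (\<integral>\<^sup>+g. (\<integral>\<^sup>+f. ?a (?q g) * ?d (- ?p f + ?q g) \<partial>?P) \<partial>?Q)"
    by (rule Fubini'[symmetric]) measurable
  also have "\<dots> = (\<integral>\<^sup>+g. ?a (?q g) * ?u \<partial>?Q)"
  proof (rule nn_integral_cong)
    fix g
    have "(\<integral>\<^sup>+f. ?a (?q g) * ?d (- ?p f + ?q g) \<partial>?P) = ?a (?q g) * (\<integral>\<^sup>+f. ?d (- ?p f + ?q g) \<partial>?P)"
      by (rule nn_integral_cmult) measurable
    also have "(\<integral>\<^sup>+f. ?d (- ?p f + ?q g) \<partial>?P) = (\<integral>\<^sup>+f. ?d (- ?q g + ?p f) \<partial>?P)"
      by (intro nn_integral_cong) (auto simp: indicator_def norm_minus_commute)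
    also have "\<dots> = (\<integral>\<^sup>+f. ?d (?p f) \<partial>?P)"
      by (rule nn_integral_coords_shift[OF B(1)]) (auto intro: span_neg q)
    finally show "(\<integral>\<^sup>+f. ?a (?q g) * ?d (- ?p f + ?q g) \<partial>?P) = ?a (?q g) * ?u"
      by (simp add: emeasure_coords_cball[OF assms(1)])
  qed
  also have "\<dots> = (\<integral>\<^sup>+g. ?a (?q g) \<partial>?Q) * ?u"
    by (rule nn_integral_multc) measurable
  finally have cancel: "(\<integral>\<^sup>+f. ?a (?p f) \<partial>?P) * ?u = (\<integral>\<^sup>+g. ?a (?q g) \<partial>?Q) * ?u" .
  have "0 < ?u" "?u \<noteq> top" by simp_all
  then have "?u \<noteq> 0" "?u \<noteq> top" by (metis less_irrefl, blast)
  with cancel have "(\<integral>\<^sup>+f. ?a (?p f) \<partial>?P) = (\<integral>\<^sup>+g. ?a (?q g) \<partial>?Q)"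
    by (metis mult_divide_eq_ennreal)
  then show "emeasure (distr ?P borel ?p) A = emeasure (distr ?Q borel ?q) A"
    using A by (simp flip: nn_integral_indicator add: nn_integral_distr)
qed simp

lemma lborel_subspace_eq:
  assumes "orthonormal_basis_of S B"
  shows "lborel_subspace S = distr (\<Pi>\<^sub>M b\<in>B. lborel) borel (coords_to_vec B)"
  unfolding lborel_subspace_def Let_def
  by (rule distr_coords_unique[OF someI[of "orthonormal_basis_of S", OF assms] assms])

end

(*
Let A be a matrix of maximal |det A| among those mapping L into the unit ball B. By John's argument
A L contains the ball of radius 1 / sqrt n, which bounds |det A| from below in terms of |L|.
Write h for the density g extended by 0. For e > 0 consider the integral of

   h x / (2 e)   over pairs (x, y) with y in B and |A x . y| <= e.

Integrating over y first, and using |A x| <= 1 on L, its limit inferior as e -> 0 is at least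
|B_(n-1)| times the total mass (Fatou). Integrating over x first, one gets means of h over thin slabs
orthogonal to v = A^T y; since h is upper semicontinuous, the reverse Fatou lemma bounds their limit
superior by the central section orthogonal to v divided by |v|. The layer cake formula shows that the
integral of 1 / |A^T y| over B is at most n / (n - 1) |B_n| |det A|^(-1/n). So neither polar
coordinates nor integration on the sphere is needed.

The same semicontinuity, applied along a convergent sequence of rotations, shows that the maximal
section is attained.
*)

theory Submission
  imports Defs
begin

subsection \<open>Linear changes of variables\<close>


text \<open>The integrand \<open>h\<close> jumps on the boundary of \<open>L\<close>, so
  \<open>h\<close> need not converge along a sequence of points approaching that boundary; upper
  semicontinuity is what remains. It suffices because the two integrations need opposite
  inequalities, Fatou from below and reverse Fatou from above. The latter needs a majorant
  independent of e; it is a multiple of 1 / |A^T y|, integrable over B because n >= 2.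

  Origin of the constants: a slab of B with half-width e / |A x| has volume about 2 e |B_(n-1)| / |A
  x|, which the factor 1 / (2 e) and |A x| <= 1 turn into the bound |B_(n-1)|. In the layer cake
  formula the measure at level t is at most |B_n| up to a crossover t = |det A|^(-1/n) and decays
  like t^(-n) beyond it; the two pieces are in the ratio 1 to 1 / (n - 1), whence n / (n - 1).
  John's inner ball gives |det A|^(-1/n) <= sqrt n |L|^(1/n) |B_n|^(-1/n), and the powers of |B_n|
  combine to the numerator of c_n.\<close>

lemma nn_integral_lborel_coords:
  fixes h :: "'a::euclidean_space \<Rightarrow> ennreal"
  assumes C: "orthonormal_basis_of UNIV C" and h [measurable]: "h \<in> borel_measurable borel"
  shows "(\<integral>\<^sup>+x. h x \<partial>lborel) = (\<integral>\<^sup>+f. h (coords_to_vec C f) \<partial>(\<Pi>\<^sub>M b\<in>C. lborel))"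
proof -
  have "orthonormal_basis_of UNIV (Basis :: 'a set)"
    by (auto simp: orthonormal_basis_of_def pairwise_def orthogonal_def inner_not_same_Basis)
  \<comment> \<open>\<open>lborel\<close> is the coordinate image for the standard basis, so basis
    independence of that image becomes rotation invariance.\<close>
  then have "distr (\<Pi>\<^sub>M b\<in>Basis. lborel) borel (coords_to_vec Basis)
      = distr (\<Pi>\<^sub>M b\<in>C. lborel) borel (coords_to_vec C :: _ \<Rightarrow> 'a)"
    by (rule distr_coords_unique[OF _ C])
  moreover have "(lborel :: 'a measure) = distr (\<Pi>\<^sub>M b\<in>Basis. lborel) borel (coords_to_vec Basis)"
    unfolding coords_to_vec_def[abs_def] by (rule lborel_eq)
  ultimately have "(\<integral>\<^sup>+x. h x \<partial>lborel) = (\<integral>\<^sup>+x. h x \<partial>distr (\<Pi>\<^sub>M b\<in>C. lborel) borel (coords_to_vec C))"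
    by metis
  then show ?thesis
    by (simp add: nn_integral_distr)
qed

lemma orthonormal_basis_of_insert:
  fixes \<xi> :: "'a::euclidean_space"
  assumes \<xi>: "norm \<xi> = 1" and B: "orthonormal_basis_of (hyperplane_perp \<xi>) B"
  shows "orthonormal_basis_of UNIV (insert \<xi> B)" "\<xi> \<notin> B"
proof -
  have *: "b \<bullet> \<xi> = 0" if "b \<in> B" for b
    using B span_base[OF that] by (auto simp: orthonormal_basis_of_def)
  have "x \<in> span (insert \<xi> B)" for x
  proof -
    have "(x - (x \<bullet> \<xi>) *\<^sub>R \<xi>) \<bullet> \<xi> = 0"
      using \<xi> by (simp add: inner_diff_left norm_eq_1)
    then have "x - (x \<bullet> \<xi>) *\<^sub>R \<xi> \<in> span B"
      using B by (auto simp: orthonormal_basis_of_def)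
    then show ?thesis
      by (auto simp: span_insert)
  qed
  then show "orthonormal_basis_of UNIV (insert \<xi> B)"
    using B \<xi> * by (auto simp: orthonormal_basis_of_def pairwise_insert orthogonal_def inner_commute)
  show "\<xi> \<notin> B"
    using *[of \<xi>] \<xi> by auto
qed

text \<open>Adding \<open>\<xi>\<close> to a basis of the hyperplane gives an orthonormal basis of
  the space; the two formulas are then Tonelli in the two orders. The first lets a shear act line by
  line, the second cuts a set into parallel hyperplane sections.\<close>

lemma nn_integral_lborel_hyperplane:
  fixes \<xi> :: "'a::euclidean_space"
  assumes \<xi>: "norm \<xi> = 1" and B: "orthonormal_basis_of (hyperplane_perp \<xi>) B"
    and h [measurable]: "h \<in> borel_measurable borel"
  shows "(\<integral>\<^sup>+x. h x \<partial>lborel)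
       = (\<integral>\<^sup>+f. (\<integral>\<^sup>+s. h (s *\<^sub>R \<xi> + coords_to_vec B f) \<partial>lborel) \<partial>(\<Pi>\<^sub>M b\<in>B. lborel))"
    and "(\<integral>\<^sup>+x. h x \<partial>lborel)
       = (\<integral>\<^sup>+s. (\<integral>\<^sup>+f. h (s *\<^sub>R \<xi> + coords_to_vec B f) \<partial>(\<Pi>\<^sub>M b\<in>B. lborel)) \<partial>lborel)"
proof -
  interpret product_sigma_finite "\<lambda>_::'a. lborel :: real measure" ..
  note ins = orthonormal_basis_of_insert[OF \<xi> B]
  have fin: "finite B" by (rule orthonormal_basis_ofD[OF B])
  have upd: "coords_to_vec (insert \<xi> B) (f(\<xi> := s)) = s *\<^sub>R \<xi> + coords_to_vec B f" for f s
    using fin ins(2) by (auto simp: coords_to_vec_def intro!: sum.cong)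
  show "(\<integral>\<^sup>+x. h x \<partial>lborel)
       = (\<integral>\<^sup>+f. (\<integral>\<^sup>+s. h (s *\<^sub>R \<xi> + coords_to_vec B f) \<partial>lborel) \<partial>(\<Pi>\<^sub>M b\<in>B. lborel))"
    unfolding nn_integral_lborel_coords[OF ins(1) h]
    by (subst product_nn_integral_insert[OF fin ins(2)]) (simp_all add: upd)
  show "(\<integral>\<^sup>+x. h x \<partial>lborel)
       = (\<integral>\<^sup>+s. (\<integral>\<^sup>+f. h (s *\<^sub>R \<xi> + coords_to_vec B f) \<partial>(\<Pi>\<^sub>M b\<in>B. lborel)) \<partial>lborel)"
    unfolding nn_integral_lborel_coords[OF ins(1) h]
    by (subst product_nn_integral_insert_rev[OF fin ins(2)]) (simp_all add: upd)
qed

text \<open>Product measures over a basis and over its rotated image live on different function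
  spaces and must be identified. A box pulls back to the box with relabelled sides, and boxes
  determine the product measure.\<close>

lemma PiM_lborel_reindex:
  assumes fin: "finite I" and p: "bij_betw p I J"
  shows "distr (\<Pi>\<^sub>M b\<in>J. lborel) (\<Pi>\<^sub>M b\<in>I. lborel) (\<lambda>f. \<lambda>i\<in>I. f (p i))
       = (\<Pi>\<^sub>M b\<in>I. lborel :: real measure)" (is "distr ?Q ?P ?t = ?P")
proof -
  interpret product_sigma_finite "\<lambda>_. lborel :: real measure" ..
  have finJ: "finite J" and pJ: "\<And>i. i \<in> I \<Longrightarrow> p i \<in> J"
    using fin p bij_betw_finite[OF p] bij_betwE[OF p] by auto
  have [measurable]: "?t \<in> measurable ?Q ?P"
    using pJ by (intro measurable_restrict measurable_component_singleton) auto
  show ?thesis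
  proof (rule PiM_eqI[OF fin])
    fix A :: "_ \<Rightarrow> real set" assume A: "\<And>i. i \<in> I \<Longrightarrow> A i \<in> sets lborel"
    let ?q = "the_inv_into I p"
    have q: "?q j \<in> I" "p (?q j) = j" if "j \<in> J" for j
      using p that by (auto simp: bij_betw_def the_inv_into_into f_the_inv_into_f)
    have q': "?q (p i) = i" if "i \<in> I" for i
      using p that by (auto simp: bij_betw_def the_inv_into_f_f)
    have "emeasure (distr ?Q ?P ?t) (Pi\<^sub>E I A) = emeasure ?Q (?t -` Pi\<^sub>E I A \<inter> space ?Q)"
      using A fin by (intro emeasure_distr) (auto intro!: sets_PiM_I_finite)
    also have "?t -` Pi\<^sub>E I A \<inter> space ?Q = (\<Pi>\<^sub>E j\<in>J. A (?q j))"
      using q q' pJ by (force simp: space_PiM PiE_iff)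
    also have "emeasure ?Q \<dots> = (\<Prod>j\<in>J. emeasure lborel (A (?q j)))"
      using A finJ q by (intro emeasure_PiM) auto
    also have "\<dots> = (\<Prod>i\<in>I. emeasure lborel (A i))"
      by (subst prod.reindex_bij_betw[OF p, symmetric]) (auto simp: q' intro!: prod.cong)
    finally show "emeasure (distr ?Q ?P ?t) (Pi\<^sub>E I A) = (\<Prod>i\<in>I. emeasure lborel (A i))" .
  qed simp
qed

lemma orthogonal_transformation_orthonormal_basis:
  fixes Q :: "'a::euclidean_space \<Rightarrow> 'a"
  assumes Q: "orthogonal_transformation Q" and B: "orthonormal_basis_of S B"
  shows "orthonormal_basis_of (Q ` S) (Q ` B)"
  using B Q
  by (auto simp: orthonormal_basis_of_def pairwise_def orthogonal_def orthogonal_transformation_def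
        orthogonal_transformation_norm linear_span_image)

text \<open>A vector and its image under \<open>Q\<close> have the same coordinates with respect to
  \<open>B\<close> and to the rotated basis. This allows rotated hyperplanes to be integrated over
  one fixed coordinate space.\<close>

lemma nn_integral_coords_orthogonal:
  fixes Q :: "'a::euclidean_space \<Rightarrow> 'a"
  assumes Q: "orthogonal_transformation Q" and B: "finite B"
    and h [measurable]: "h \<in> borel_measurable borel"
  shows "(\<integral>\<^sup>+f. h (coords_to_vec (Q ` B) f) \<partial>(\<Pi>\<^sub>M b\<in>Q ` B. lborel))
       = (\<integral>\<^sup>+f. h (Q (coords_to_vec B f)) \<partial>(\<Pi>\<^sub>M b\<in>B. lborel))"
proof -
  have inj: "inj_on Q B"
    using orthogonal_transformation_inj[OF Q] by (auto intro: inj_on_subset)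
  have lin: "linear Q"
    using Q by (rule orthogonal_transformation_linear)
  have [measurable]: "Q \<in> borel_measurable borel"
    using lin by (intro borel_measurable_continuous_onI linear_continuous_on linear_conv_bounded_linear[THEN iffD1])
  have *: "(\<lambda>f. \<lambda>b\<in>B. f (Q b)) \<in> measurable (\<Pi>\<^sub>M b\<in>Q ` B. lborel) (\<Pi>\<^sub>M b\<in>B. lborel :: real measure)"
    by (intro measurable_restrict measurable_component_singleton) auto
  have "coords_to_vec (Q ` B) f = Q (coords_to_vec B (\<lambda>b\<in>B. f (Q b)))" for f
    using inj by (simp add: coords_to_vec_def sum.reindex linear_sum[OF lin] linear_scale[OF lin])
  then have "(\<integral>\<^sup>+f. h (coords_to_vec (Q ` B) f) \<partial>(\<Pi>\<^sub>M b\<in>Q ` B. lborel))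
     = (\<integral>\<^sup>+f. h (Q (coords_to_vec B f)) \<partial>distr (\<Pi>\<^sub>M b\<in>Q ` B. lborel) (\<Pi>\<^sub>M b\<in>B. lborel) (\<lambda>f. \<lambda>b\<in>B. f (Q b)))"
    by (subst nn_integral_distr[OF *]) auto
  then show ?thesis
    using PiM_lborel_reindex[OF B, of Q "Q ` B"] inj by (simp add: bij_betw_def)
qed

lemma nn_integral_orthogonal:
  fixes Q :: "'a::euclidean_space \<Rightarrow> 'a"
  assumes Q: "orthogonal_transformation Q" and h [measurable]: "h \<in> borel_measurable borel"
  shows "(\<integral>\<^sup>+x. h (Q x) \<partial>lborel) = (\<integral>\<^sup>+x. h x \<partial>lborel)"
proof -
  obtain B :: "'a set" where B: "orthonormal_basis_of UNIV B"
    using orthonormal_basis_of_exists subspace_UNIV by blast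
  have "orthonormal_basis_of UNIV (Q ` B)"
    using orthogonal_transformation_orthonormal_basis[OF Q B] orthogonal_transformation_surj[OF Q] by simp
  then have "(\<integral>\<^sup>+x. h x \<partial>lborel) = (\<integral>\<^sup>+f. h (Q (coords_to_vec B f)) \<partial>(\<Pi>\<^sub>M b\<in>B. lborel))"
    using Q orthonormal_basis_ofD[OF B]
    by (simp add: nn_integral_lborel_coords nn_integral_coords_orthogonal)
  moreover have "Q \<in> borel_measurable borel"
    using orthogonal_transformation_linear[OF Q]
    by (intro borel_measurable_continuous_onI linear_continuous_on linear_conv_bounded_linear[THEN iffD1])
  ultimately show ?thesis
    by (simp add: nn_integral_lborel_coords[OF B])
qed

text \<open>On each line parallel to the \<open>m\<close>-th axis the shear is a translation by the
  \<open>n\<close>-th coordinate, which is constant on that line because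
  \<open>m \<noteq> n\<close>.\<close>

lemma nn_integral_shear:
  fixes h :: "real ^ 'n \<Rightarrow> ennreal"
  assumes "m \<noteq> n" and h [measurable]: "h \<in> borel_measurable borel"
  shows "(\<integral>\<^sup>+x. h (\<chi> i. if i = m then x $ m + x $ n else x $ i) \<partial>lborel) = (\<integral>\<^sup>+x. h x \<partial>lborel)"
proof -
  let ?\<xi> = "axis m 1 :: real ^ 'n" and ?F = "\<lambda>x::real^'n. x + (x $ n) *\<^sub>R axis m 1"
  have [measurable]: "?F \<in> borel_measurable borel"
    by (intro borel_measurable_continuous_onI continuous_intros)
  have \<xi>: "norm ?\<xi> = 1" by simp
  obtain B where B: "orthonormal_basis_of (hyperplane_perp ?\<xi>) B"
    using orthonormal_basis_of_exists subspace_hyperplane2[of ?\<xi>] by (auto simp: inner_commute)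
  have eq: "(\<chi> i. if i = m then x $ m + x $ n else x $ i) = ?F x" for x :: "real^'n"
    by (auto simp: vec_eq_iff axis_def)
  \<comment> \<open>The factor \<open>1 *\<close> brings the argument into the form of
    \<open>nn_integral_real_affine\<close>.\<close>
  have F: "?F (s *\<^sub>R ?\<xi> + w) = (w $ n + 1 * s) *\<^sub>R ?\<xi> + w" for s w
    using \<open>m \<noteq> n\<close> by (simp add: algebra_simps) (simp add: axis_def)
  have "(\<integral>\<^sup>+x. h (?F x) \<partial>lborel)
     = (\<integral>\<^sup>+f. (\<integral>\<^sup>+s. h (?F (s *\<^sub>R ?\<xi> + coords_to_vec B f)) \<partial>lborel) \<partial>(\<Pi>\<^sub>M b\<in>B. lborel))"
    by (rule nn_integral_lborel_hyperplane(1)[OF \<xi> B]) measurable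
  also have "\<dots> = (\<integral>\<^sup>+f. (\<integral>\<^sup>+s. h (s *\<^sub>R ?\<xi> + coords_to_vec B f) \<partial>lborel) \<partial>(\<Pi>\<^sub>M b\<in>B. lborel))"
  proof (rule nn_integral_cong)
    fix f
    show "(\<integral>\<^sup>+s. h (?F (s *\<^sub>R ?\<xi> + coords_to_vec B f)) \<partial>lborel)
      = (\<integral>\<^sup>+s. h (s *\<^sub>R ?\<xi> + coords_to_vec B f) \<partial>lborel)"
      unfolding F
      using nn_integral_real_affine[of "\<lambda>s. h (s *\<^sub>R ?\<xi> + coords_to_vec B f)" 1 "coords_to_vec B f $ n"]
      by simp
  qed
  also have "\<dots> = (\<integral>\<^sup>+x. h x \<partial>lborel)"
    by (rule nn_integral_lborel_hyperplane(1)[OF \<xi> B, symmetric]) measurable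
  finally show ?thesis
    unfolding eq .
qed

lemma nn_integral_diagonal:
  fixes h :: "real ^ 'n \<Rightarrow> ennreal"
  assumes c: "\<And>i. c i \<noteq> 0" and h [measurable]: "h \<in> borel_measurable borel"
  shows "(\<integral>\<^sup>+x. h x \<partial>lborel) = ennreal \<bar>\<Prod>i\<in>UNIV. c i\<bar> * (\<integral>\<^sup>+x. h (\<chi> i. c i * x $ i) \<partial>lborel)"
proof -
  define d where "d = (\<chi> i. c i)"
  let ?T = "\<lambda>x::real^'n. 0 + (\<Sum>j\<in>Basis. ((d \<bullet> j) * (x \<bullet> j)) *\<^sub>R j)"
  have T: "?T x = (\<chi> i. c i * x $ i)" for x
  proof -
    have "?T x = (\<Sum>i\<in>UNIV. (c i * x $ i) *\<^sub>R axis i 1)"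
      unfolding Basis_vec_def
      by (subst sum.UNION_disjoint) (auto simp: d_def inner_axis axis_eq_axis)
    also have "\<dots> = (\<chi> i. c i * x $ i)"
      by (auto simp: vec_eq_iff axis_def if_distrib cong: if_cong)
    finally show ?thesis .
  qed
  have Tm: "?T \<in> borel_measurable borel"
    by (intro borel_measurable_continuous_onI continuous_intros)
  have "(\<Prod>j\<in>Basis. d \<bullet> j) = (\<Prod>i\<in>UNIV. c i)"
    unfolding Basis_vec_def
    by (subst prod.UNION_disjoint) (auto simp: d_def inner_axis axis_eq_axis)
  then have p: "(\<Prod>j\<in>Basis. \<bar>d \<bullet> j\<bar>) = \<bar>\<Prod>i\<in>UNIV. c i\<bar>"
    by (metis abs_prod)
  have "lborel = density (distr lborel borel ?T) (\<lambda>_. (\<Prod>j\<in>Basis. \<bar>d \<bullet> j\<bar>))"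
    using c by (intro lborel_affine_euclidean) (auto simp: d_def Basis_vec_def inner_axis)
  then have "(\<integral>\<^sup>+x. h x \<partial>lborel) = (\<integral>\<^sup>+x. h x \<partial>density (distr lborel borel ?T) (\<lambda>_. (\<Prod>j\<in>Basis. \<bar>d \<bullet> j\<bar>)))"
    by simp
  also have "\<dots> = ennreal \<bar>\<Prod>i\<in>UNIV. c i\<bar> * (\<integral>\<^sup>+x. h (?T x) \<partial>lborel)"
    using Tm by (simp add: nn_integral_density nn_integral_distr nn_integral_cmult p)
  finally show ?thesis
    unfolding T .
qed

text \<open>Induction over a factorisation into elementary maps. \<open>h\<close> is quantified
  inside the induction because for \<open>f \<circ> g\<close> the hypothesis on \<open>g\<close> is
  applied to \<open>h\<close> composed with \<open>f\<close>. Keeping the determinant condition as a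
  premise makes the singular elementary maps vacuous.\<close>

lemma nn_integral_linear_transformation:
  fixes f :: "real ^ 'n \<Rightarrow> real ^ 'n" and h :: "real ^ 'n \<Rightarrow> ennreal"
  assumes "linear f" and "det (matrix f) \<noteq> 0" and "h \<in> borel_measurable borel"
  shows "(\<integral>\<^sup>+x. h x \<partial>lborel) = ennreal \<bar>det (matrix f)\<bar> * (\<integral>\<^sup>+x. h (f x) \<partial>lborel)"
proof -
  have "det (matrix f) \<noteq> 0 \<longrightarrow> (\<forall>h :: real ^ 'n \<Rightarrow> ennreal. h \<in> borel_measurable borel \<longrightarrow>
     (\<integral>\<^sup>+x. h x \<partial>lborel) = ennreal \<bar>det (matrix f)\<bar> * (\<integral>\<^sup>+x. h (f x) \<partial>lborel))"
  proof (induction rule: induct_linear_elementary[OF \<open>linear f\<close>])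
    case (1 f g)
    have fm: "f \<in> borel_measurable borel"
      using 1 by (intro borel_measurable_continuous_onI linear_continuous_on linear_conv_bounded_linear[THEN iffD1])
    show ?case
    proof (intro impI allI)
      fix h :: "real ^ 'n \<Rightarrow> ennreal" assume h: "h \<in> borel_measurable borel"
      assume "det (matrix (f \<circ> g)) \<noteq> 0"
      then have d: "det (matrix f) \<noteq> 0" "det (matrix g) \<noteq> 0"
        and dfg: "\<bar>det (matrix (f \<circ> g))\<bar> = \<bar>det (matrix f)\<bar> * \<bar>det (matrix g)\<bar>"
        using 1 by (simp_all add: matrix_compose det_mul abs_mult)
      have "(\<integral>\<^sup>+x. h x \<partial>lborel) = ennreal \<bar>det (matrix f)\<bar> * (\<integral>\<^sup>+x. h (f x) \<partial>lborel)"
        using 1 d h by blast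
      also have "(\<integral>\<^sup>+x. h (f x) \<partial>lborel) = ennreal \<bar>det (matrix g)\<bar> * (\<integral>\<^sup>+x. h (f (g x)) \<partial>lborel)"
        using 1 d(2) measurable_compose[OF fm h] by blast
      finally show "(\<integral>\<^sup>+x. h x \<partial>lborel)
          = ennreal \<bar>det (matrix (f \<circ> g))\<bar> * (\<integral>\<^sup>+x. h ((f \<circ> g) x) \<partial>lborel)"
        by (simp add: dfg ennreal_mult mult.assoc)
    qed
  next
    case (2 f i)
    then have "row i (matrix f) = 0"
      by (simp add: row_def matrix_def vec_eq_iff)
    then show ?case
      using det_zero_row by blast
  next
    case (3 c)
    have "det (matrix (\<lambda>x::real^'n. \<chi> i. c i * x $ i)) = (\<Prod>i\<in>UNIV. c i)"
      by (subst det_diagonal) (auto simp: matrix_def axis_def)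
    then show ?case
      using nn_integral_diagonal[of c] by (auto simp: prod_zero_iff)
  next
    case (4 m n)
    let ?f = "\<lambda>x::real^'n. \<chi> i. x $ Transposition.transpose m n i"
    have "linear ?f"
      by (auto intro!: linearI simp: vec_eq_iff)
    moreover have "?f v \<bullet> ?f w = v \<bullet> w" for v w
      using sum.reindex_bij_betw[OF bij_transpose[of m n], of "\<lambda>i. v $ i \<bullet> w $ i"]
      by (simp add: inner_vec_def)
    ultimately have o: "orthogonal_transformation ?f"
      by (simp add: orthogonal_transformation_def)
    have "\<bar>det (matrix ?f)\<bar> = 1"
      by (rule orthogonal_transformation_det[OF o])
    then show ?case
      using nn_integral_orthogonal[OF o] by simp
  next
    case (5 m n)
    let ?f = "\<lambda>x::real^'n. \<chi> i. if i = m then x $ m + x $ n else x $ i"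
    have "matrix ?f = (\<chi> k. if k = m then row m (mat 1) + 1 *s row n (mat 1) else row k (mat 1))"
      by (auto simp: matrix_def row_def mat_def axis_def vec_eq_iff)
    then have "det (matrix ?f) = 1"
      using det_row_operation[OF 5, of "mat 1 :: real^'n^'n" 1] by simp
    then show ?case
      using nn_integral_shear[OF 5] by simp
  qed
  with assms show ?thesis
    by blast
qed

text \<open>Used twice: for John's inner ellipsoid with \<open>r\<close> equal to 1 / sqrt n, and
  for the transposed matrix with \<open>r = 1 / t\<close> in the layer cake formula.\<close>

lemma emeasure_matrix_norm_le:
  fixes A :: "real ^ 'n ^ 'n"
  assumes A: "det A \<noteq> 0" and r: "0 \<le> r"
  shows "emeasure lborel {x. norm (A *v x) \<le> r}
       = ennreal (unit_ball_vol (real CARD('n)) * r ^ CARD('n) / \<bar>det A\<bar>)"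
proof -
  have [measurable]: "(*v) A \<in> borel_measurable borel"
    by (intro borel_measurable_continuous_onI matrix_vector_mult_linear_continuous_on)
  have "ennreal (unit_ball_vol (real CARD('n)) * r ^ CARD('n)) = emeasure lborel (cball (0::real^'n) r)"
    using r by (simp add: emeasure_cball)
  also have "\<dots> = (\<integral>\<^sup>+x. indicator (cball (0::real^'n) r) x \<partial>lborel)"
    by simp
  also have "\<dots> = ennreal \<bar>det A\<bar> * (\<integral>\<^sup>+x. indicator (cball 0 r) (A *v x) \<partial>lborel)"
    using nn_integral_linear_transformation[of "(*v) A" "indicator (cball 0 r)"] A
    by (simp del: nn_integral_indicator add: borel_measurable_indicator)
  also have "(\<integral>\<^sup>+x. indicator (cball 0 r) (A *v x) \<partial>lborel)
      = (\<integral>\<^sup>+x. indicator {x. norm (A *v x) \<le> r} x \<partial>lborel)"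
    by (intro nn_integral_cong) (auto simp: indicator_def)
  also have "\<dots> = emeasure lborel {x. norm (A *v x) \<le> r}"
    by (rule nn_integral_indicator) measurable
  finally have "ennreal (unit_ball_vol (real CARD('n)) * r ^ CARD('n))
     = ennreal \<bar>det A\<bar> * emeasure lborel {x. norm (A *v x) \<le> r}" .
  then have "ennreal (inverse \<bar>det A\<bar>) * ennreal (unit_ball_vol (real CARD('n)) * r ^ CARD('n))
     = emeasure lborel {x. norm (A *v x) \<le> r}"
    using A by (simp add: mult.assoc[symmetric] flip: ennreal_mult)
  then show ?thesis
    using r by (simp add: field_simps flip: ennreal_mult)
qed

subsection \<open>John's ellipsoid\<close>


text \<open>If a ball around \<open>z\<close> lies in \<open>L\<close>, then a short vector
  \<open>y\<close> is the midpoint of \<open>z + y\<close> and \<open>- (z - y)\<close>, and the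
  latter is in \<open>L\<close> by symmetry.\<close>

lemma origin_symmetric_convex_body_ball:
  fixes L :: "'a::euclidean_space set"
  assumes L: "origin_symmetric_convex_body L"
  obtains r where "0 < r" "ball 0 r \<subseteq> L"
proof -
  have conv: "convex L" and sym: "uminus ` L = L"
    using L by (auto simp: origin_symmetric_convex_body_def)
  obtain z r where r: "0 < r" "ball z r \<subseteq> L"
    using L unfolding origin_symmetric_convex_body_def
    by (metis equals0I interior_subset mem_interior)
  have "y \<in> L" if "y \<in> ball 0 r" for y
  proof -
    have "z + y \<in> L"
      using r(2) that by (auto simp: dist_norm)
    moreover have "z - y \<in> L"
      using r(2) that by (auto simp: dist_norm)
    then have "- (z - y) \<in> L"
      using sym by blast
    ultimately have "(1/2) *\<^sub>R (z + y) + (1/2) *\<^sub>R (- (z - y)) \<in> L"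
      using conv by (auto simp: convex_def)
    then show ?thesis
      by (simp add: algebra_simps flip: scaleR_add_left)
  qed
  with r(1) that show thesis by blast
qed

lemma continuous_on_det [continuous_intros]:
  fixes A :: "'a::topological_space \<Rightarrow> real ^ 'n ^ 'n"
  assumes "continuous_on S A"
  shows "continuous_on S (\<lambda>x. det (A x))"
  unfolding det_def by (intro continuous_intros assms)

lemma closed_matrices_norm_le:
  "closed {A :: real ^ 'n ^ 'm. \<forall>x\<in>L. norm (A *v x) \<le> c}"
proof -
  have "{A :: real ^ 'n ^ 'm. \<forall>x\<in>L. norm (A *v x) \<le> c} = (\<Inter>x\<in>L. {A. norm (A *v x) \<le> c})"
    by auto
  moreover have "continuous_on UNIV (\<lambda>A :: real ^ 'n ^ 'm. A *v x)" for x
    unfolding matrix_vector_mult_def by (intro continuous_intros)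
  ultimately show ?thesis
    by (auto intro!: closed_INT closed_Collect_le continuous_intros)
qed

lemma bounded_matrices_norm_le:
  fixes L :: "(real ^ 'n) set"
  assumes r: "0 < r" and L: "ball 0 r \<subseteq> L"
  shows "bounded {A :: real ^ 'n ^ 'm. \<forall>x\<in>L. norm (A *v x) \<le> c}"
proof -
  have "norm A \<le> (\<Sum>i\<in>(UNIV::'m set). \<Sum>j\<in>(UNIV::'n set). 2 * c / r)"
    if A: "\<forall>x\<in>L. norm (A *v x) \<le> c" for A :: "real ^ 'n ^ 'm"
  proof -
    have ent: "\<bar>A $ i $ j\<bar> \<le> 2 * c / r" for i j
    proof -
      \<comment> \<open>Half the radius, since the ball is open. The images of these vectors bound
        the columns of \<open>A\<close>.\<close>
      have "(r / 2) *\<^sub>R axis j 1 \<in> L"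
        using L r by (auto simp: subset_iff)
      then have "norm (A *v ((r / 2) *\<^sub>R axis j 1)) \<le> c"
        using A by blast
      moreover have "A *v ((r / 2) *\<^sub>R axis j 1) = (r / 2) *\<^sub>R column j A"
        by (simp add: matrix_vector_mult_scaleR matrix_vector_mult_basis)
      ultimately have "(r / 2) * norm (column j A) \<le> c"
        using r by simp
      moreover have "\<bar>A $ i $ j\<bar> \<le> norm (column j A)"
        using component_le_norm_cart[of "column j A" i] by (simp add: column_def)
      ultimately show ?thesis
        using r by (simp add: field_simps) (smt (verit) mult_left_mono)
    qed
    have "norm A \<le> (\<Sum>i\<in>UNIV. norm (A $ i))"
      unfolding norm_vec_def by (intro L2_set_le_sum) auto
    also have "\<dots> \<le> (\<Sum>i\<in>(UNIV::'m set). \<Sum>j\<in>(UNIV::'n set). \<bar>A $ i $ j\<bar>)"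
      by (intro sum_mono norm_le_l1_cart)
    also have "\<dots> \<le> (\<Sum>i\<in>(UNIV::'m set). \<Sum>j\<in>(UNIV::'n set). 2 * c / r)"
      by (intro sum_mono ent)
    finally show ?thesis .
  qed
  then show ?thesis
    unfolding bounded_iff by blast
qed

text \<open>Here \<open>a\<close> is the square of a half-width, and \<open>\<alpha>\<close>,
  \<open>\<beta>\<close> are squares of stretch factors. With
  \<open>\<alpha> = 1 + \<delta> * (1 - a)\<close> and \<open>\<beta> = 1 - \<delta> * a\<close> the
  third condition is an equality for every \<open>\<delta>\<close>, while the product in the fourth
  is 1 + \<open>\<delta>\<close> (1 - n a) to first order. This is where the threshold 1 / sqrt n
  comes from. Bernoulli's inequality controls the power, and \<open>\<delta>\<close> is small enough
  for the remaining quadratic term.\<close>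

lemma stretch_factor_exists:
  fixes a :: real
  assumes "n \<ge> 1" and a: "0 \<le> a" "real n * a < 1"
  obtains \<alpha> \<beta> where "0 < \<beta>" "\<beta> \<le> \<alpha>" "\<beta> + (\<alpha> - \<beta>) * a \<le> 1" "1 < \<alpha> * \<beta> ^ (n - 1)"
proof -
  define \<delta> where "\<delta> = (1 - real n * a) / 2"
  have \<delta>: "0 < \<delta>" "\<delta> < 1 - real n * a" "\<delta> \<le> 1/2"
    using a by (auto simp: \<delta>_def field_simps)
  have "1 * a \<le> real n * a"
    using assms by (intro mult_right_mono) auto
  then have a1: "a < 1" using a by simp
  have n1: "(real n - 1) * a < 1" using a by (simp add: algebra_simps)
  have da: "\<delta> * a \<le> 1/2" using \<delta> a a1 mult_mono[of \<delta> "1/2" a 1] by simp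
  have n0: "0 \<le> real n - 1" using assms by simp
  have "(1 - a) * ((real n - 1) * a) \<le> 1 * 1"
    using a a1 n0 n1 by (intro mult_mono) auto
  then have "\<delta> * ((1 - a) * ((real n - 1) * a)) \<le> \<delta> * 1"
    using \<delta> by (intro mult_left_mono) auto
  then have "0 < \<delta> * (1 - real n * a - \<delta> * ((1 - a) * ((real n - 1) * a)))"
    using \<delta> by (intro mult_pos_pos) linarith+
  then have "1 < (1 + \<delta> * (1 - a)) * (1 + (real n - 1) * (- (\<delta> * a)))"
    by (simp add: algebra_simps power2_eq_square)
  also have "\<dots> \<le> (1 + \<delta> * (1 - a)) * (1 + - (\<delta> * a)) ^ (n - 1)"
    using Bernoulli_inequality[of "- (\<delta> * a)" "n - 1"] da \<delta> a1 assms
    by (intro mult_left_mono) (auto simp: of_nat_diff)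
  finally have "1 < (1 + \<delta> * (1 - a)) * (1 - \<delta> * a) ^ (n - 1)" by simp
  moreover have "(1 - \<delta> * a) + ((1 + \<delta> * (1 - a)) - (1 - \<delta> * a)) * a \<le> 1"
    by (simp add: algebra_simps)
  moreover have "1 - \<delta> * a \<le> 1 + \<delta> * (1 - a)"
    using \<delta> by (simp add: algebra_simps)
  ultimately show thesis
    using that[of "1 - \<delta> * a" "1 + \<delta> * (1 - a)"] da by auto
qed

text \<open>If \<open>A L\<close> lies in the unit ball and in a slab of half-width less than \<open>1 / sqrt n\<close>, then
  stretching along the normal \<open>u\<close> of the slab while shrinking slightly in the orthogonal directions
  keeps \<open>L\<close> inside the ball and increases the determinant.\<close>

lemma det_increase_of_slab:
  fixes A :: "real ^ 'n ^ 'n"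
  assumes A: "det A \<noteq> 0" and AL: "\<And>x. x \<in> L \<Longrightarrow> norm (A *v x) \<le> 1"
    and u: "norm u = 1" and a: "0 \<le> a" "real CARD('n) * a\<^sup>2 < 1"
    and slab: "\<And>x. x \<in> L \<Longrightarrow> \<bar>u \<bullet> (A *v x)\<bar> \<le> a"
  obtains A' :: "real ^ 'n ^ 'n" where "\<bar>det A\<bar> < \<bar>det A'\<bar>" "\<And>x. x \<in> L \<Longrightarrow> norm (A' *v x) \<le> 1"
proof -
  fix k :: 'n
  obtain \<alpha> \<beta> where ab: "0 < \<beta>" "\<beta> \<le> \<alpha>" "\<beta> + (\<alpha> - \<beta>) * a\<^sup>2 \<le> 1" "1 < \<alpha> * \<beta> ^ (CARD('n) - 1)"
    using stretch_factor_exists[of "CARD('n)" "a\<^sup>2"] a by (metis Suc_leI One_nat_def zero_less_card_finite zero_le_power2)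
  obtain Q where Q: "orthogonal_matrix Q" "Q *v axis k 1 = u"
    using orthogonal_matrix_exists_basis[OF u] by blast
  have Qt: "orthogonal_transformation ((*v) (transpose Q))"
    using Q(1) by (simp add: orthogonal_transformation_matrix)
  define D :: "real ^ 'n ^ 'n" where "D = (\<chi> i j. if i = j then (if i = k then sqrt \<alpha> else sqrt \<beta>) else 0)"
  \<comment> \<open>The transpose of \<open>Q\<close> carries \<open>u\<close> to the axis
    \<open>k\<close>, along which \<open>D\<close> stretches. \<open>D\<close> has square roots
    because \<open>\<alpha>\<close> and \<open>\<beta>\<close> act on squared lengths.\<close>
  define A' where "A' = D ** (transpose Q ** A)"
  have dQ: "\<bar>det (transpose Q)\<bar> = 1"
    using orthogonal_transformation_det[OF Qt] by simp
  have dD: "det D = sqrt \<alpha> * sqrt \<beta> ^ (CARD('n) - 1)"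
  proof -
    have "det D = (\<Prod>i\<in>UNIV. if i = k then sqrt \<alpha> else sqrt \<beta>)"
      by (subst det_diagonal) (auto simp: D_def)
    also have "\<dots> = sqrt \<alpha> * (\<Prod>i\<in>UNIV - {k}. sqrt \<beta>)"
      by (subst prod.remove[of _ k]) auto
    finally show ?thesis
      by (simp add: card_Diff_singleton)
  qed
  have "1 < sqrt (\<alpha> * \<beta> ^ (CARD('n) - 1))"
    using ab(4) by simp
  then have "1 < \<bar>det D\<bar>"
    unfolding dD real_sqrt_mult real_sqrt_power by linarith
  then have det: "\<bar>det A\<bar> < \<bar>det A'\<bar>"
    using A dQ by (simp add: A'_def det_mul abs_mult)
  have "norm (A' *v x) \<le> 1" if "x \<in> L" for x
  proof -
    define y where "y = transpose Q *v (A *v x)"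
    have yk: "y $ k = u \<bullet> (A *v x)"
      unfolding y_def Q(2)[symmetric]
      by (metis dot_lmul_matrix inner_axis' inner_commute inner_real_def mult_1 transpose_matrix_vector vector_transpose_matrix)
    have ny: "norm y \<le> 1"
      unfolding y_def using orthogonal_transformation_norm[OF Qt] AL[OF that] by simp
    have yn: "(norm z)\<^sup>2 = (z $ k)\<^sup>2 + (\<Sum>i\<in>UNIV-{k}. (z $ i)\<^sup>2)" for z :: "real ^ 'n"
      unfolding power2_norm_eq_inner inner_vec_def
      by (subst sum.remove[of _ k]) (auto simp: power2_eq_square)
    have Dy: "(D *v y) $ i = (if i = k then sqrt \<alpha> else sqrt \<beta>) * y $ i" for i
      by (simp add: D_def matrix_vector_mult_def if_distrib[of "\<lambda>t. t * _"] cong: if_cong)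
    have "(norm (D *v y))\<^sup>2 = \<alpha> * (y $ k)\<^sup>2 + \<beta> * (\<Sum>i\<in>UNIV-{k}. (y $ i)\<^sup>2)"
      using ab unfolding yn Dy by (simp add: power_mult_distrib sum_distrib_left)
    \<comment> \<open>In this form both known bounds, on \<open>norm y\<close> and on the component
      along \<open>u\<close>, enter with nonnegative coefficients.\<close>
    also have "\<dots> = \<beta> * (norm y)\<^sup>2 + (\<alpha> - \<beta>) * (y $ k)\<^sup>2"
      unfolding yn by (simp add: algebra_simps)
    also have "\<dots> \<le> \<beta> * 1 + (\<alpha> - \<beta>) * a\<^sup>2"
      using ab ny slab[OF that] a(1)
      by (intro add_mono mult_left_mono) (auto simp: yk power_le_one abs_le_square_iff[symmetric])
    also have "\<dots> \<le> 1" using ab by simp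
    finally have "norm (D *v y) \<le> 1"
      by (simp add: power_le_one_iff)
    then show ?thesis
      by (simp add: A'_def y_def matrix_vector_mul_assoc)
  qed
  with det that show thesis by blast
qed

text \<open>The interior of \<open>L\<close> makes the set of admissible matrices compact, so a
  maximal determinant exists. A point of the small ellipsoid outside \<open>L\<close> could be
  separated from \<open>L\<close>; symmetry turns the separating half-space into a slab around
  \<open>L\<close>, whose image under \<open>A\<close> is narrow enough for
  \<open>det_increase_of_slab\<close> to contradict maximality.\<close>

lemma john_ellipsoid:
  fixes L :: "(real ^ 'n) set"
  assumes L: "origin_symmetric_convex_body L"
  obtains A :: "real ^ 'n ^ 'n" where "det A \<noteq> 0" "\<And>x. x \<in> L \<Longrightarrow> norm (A *v x) \<le> 1"
    "\<And>x. norm (A *v x) \<le> 1 / sqrt (real CARD('n)) \<Longrightarrow> x \<in> L"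
proof -
  have cpt: "compact L" and conv: "convex L" and sym: "uminus ` L = L"
    using L by (auto simp: origin_symmetric_convex_body_def)
  obtain r where r: "0 < r" "ball 0 r \<subseteq> L"
    using origin_symmetric_convex_body_ball[OF L] .
  obtain R where R: "0 < R" "\<And>x. x \<in> L \<Longrightarrow> norm x \<le> R"
    using compact_imp_bounded[OF cpt] unfolding bounded_pos by blast
  let ?S = "{A :: real ^ 'n ^ 'n. \<forall>x\<in>L. norm (A *v x) \<le> 1}"
  have "compact ?S"
    using closed_matrices_norm_le bounded_matrices_norm_le[OF r] by (auto simp: compact_eq_bounded_closed)
  \<comment> \<open>A competitor with nonzero determinant, which forces the maximiser to be
    invertible.\<close>
  moreover have S0: "(1 / R) *\<^sub>R mat 1 \<in> ?S"
    using R by (auto simp: scaleR_matrix_vector_assoc[symmetric] field_simps)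
  moreover have "continuous_on ?S (\<lambda>A. \<bar>det A\<bar>)"
    by (intro continuous_intros)
  ultimately obtain A where A: "A \<in> ?S" and max: "\<And>A'. A' \<in> ?S \<Longrightarrow> \<bar>det A'\<bar> \<le> \<bar>det A\<bar>"
    using continuous_attains_sup[of ?S "\<lambda>A. \<bar>det A\<bar>"] by blast
  have "det ((1 / R) *\<^sub>R mat 1 :: real ^ 'n ^ 'n) \<noteq> 0"
    using R(1) by (subst det_diagonal) (auto simp: mat_def)
  with max[OF S0] have det: "det A \<noteq> 0"
    by auto
  have AL: "norm (A *v x) \<le> 1" if "x \<in> L" for x
    using A that by blast
  have "z \<in> L" if z: "norm (A *v z) \<le> 1 / sqrt (real CARD('n))" for z
  proof (rule ccontr)
    assume "z \<notin> L"
    then obtain p b where pb: "p \<bullet> z < b" "\<And>x. x \<in> L \<Longrightarrow> b < p \<bullet> x"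
      using separating_hyperplane_closed_point[OF conv compact_imp_closed[OF cpt]] by blast
    have "0 \<in> L" using r by auto
    then have b: "b < 0" using pb(2) by force
    have pL: "\<bar>p \<bullet> x\<bar> < - b" if "x \<in> L" for x
      using pb(2)[OF that] pb(2)[of "- x"] that sym by (force simp: abs_if)
    obtain C where inv: "C ** A = mat 1"
      using det by (metis invertible_det_nz invertible_left_inverse)
    \<comment> \<open>The normal of the slab after applying \<open>A\<close>: the inverse transpose
      of \<open>A\<close> applied to \<open>p\<close>.\<close>
    define w where "w = transpose C *v p"
    have w: "w \<bullet> (A *v x) = p \<bullet> x" for x
    proof -
      have "w \<bullet> (A *v x) = p \<bullet> (C *v (A *v x))"
        unfolding w_def by (simp add: dot_lmul_matrix)
      then show ?thesis
        by (simp add: matrix_vector_mul_assoc inv)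
    qed
    have "- b < \<bar>w \<bullet> (A *v z)\<bar>"
      using pb(1) b by (simp add: w)
    also have "\<dots> \<le> norm w * (1 / sqrt (real CARD('n)))"
      using Cauchy_Schwarz_ineq2[of w "A *v z"] z
      by (meson dual_order.trans mult_left_mono norm_ge_zero)
    \<comment> \<open>Equivalently, the image slab has half-width \<open>- b / norm w\<close> below
      1 / sqrt n.\<close>
    finally have nw: "- b * sqrt (real CARD('n)) < norm w"
      by (simp add: field_simps)
    moreover have "0 < - b * sqrt (real CARD('n))"
      using b by (simp add: mult_neg_pos)
    ultimately have w0: "0 < norm w" by linarith
    have "(- b * sqrt (real CARD('n)))\<^sup>2 < (norm w)\<^sup>2"
      using nw b by (intro power_strict_mono) (auto simp: mult_nonpos_nonneg)
    then have "real CARD('n) * (- b / norm w)\<^sup>2 < 1"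
      using w0 by (simp add: power_mult_distrib power_divide field_simps)
    moreover have "0 \<le> - b / norm w"
      using b w0 by (intro divide_nonneg_pos) auto
    moreover have "\<bar>(w /\<^sub>R norm w) \<bullet> (A *v x)\<bar> \<le> - b / norm w" if "x \<in> L" for x
    proof -
      have "\<bar>(w /\<^sub>R norm w) \<bullet> (A *v x)\<bar> = \<bar>p \<bullet> x\<bar> / norm w"
        by (simp add: w abs_mult divide_inverse mult.commute)
      also have "\<dots> \<le> - b / norm w"
        using pL[OF that] w0 by (intro divide_right_mono) auto
      finally show ?thesis .
    qed
    moreover have "norm (w /\<^sub>R norm w) = 1"
      using w0 by simp
    ultimately obtain A' :: "real ^ 'n ^ 'n" where "\<bar>det A\<bar> < \<bar>det A'\<bar>" "\<And>x. x \<in> L \<Longrightarrow> norm (A' *v x) \<le> 1"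
      using det_increase_of_slab[OF det AL] by metis
    with max[of A'] show False by auto
  qed
  with det AL that show thesis by blast
qed

subsection \<open>Ellipsoids, balls and slabs\<close>


text \<open>Layer cake: 1 / |M y| is the length of the set of t >= 0 with t |M y| <= 1. For fixed t,
  the points \<open>y\<close> of the ball with this property have measure at most that of the ball
  and at most that of the ellipsoid |M y| <= 1 / t. Integrating the better bound gives V s + V s /
  (n - 1).\<close>

lemma nn_integral_inverse_norm_matrix_le:
  fixes M :: "real ^ 'n ^ 'n"
  assumes M: "det M \<noteq> 0" and n: "n = CARD('n)" "2 \<le> n"
  shows "(\<integral>\<^sup>+y. ennreal (1 / norm (M *v y)) * indicator (cball 0 1) y \<partial>lborel)
       \<le> ennreal (real n / (real n - 1) * unit_ball_vol (real n) * \<bar>det M\<bar> powr (- 1 / real n))"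
proof -
  define V where "V = unit_ball_vol (real n)"
  \<comment> \<open>The level at which the ellipsoid |M y| <= 1 / t has the volume of the unit ball,
    that is, where the two bounds cross.\<close>
  define s where "s = \<bar>det M\<bar> powr (- 1 / real n)"
  have V: "0 < V" unfolding V_def by simp
  have s: "0 < s" unfolding s_def using M by simp
  have sn: "s ^ n = 1 / \<bar>det M\<bar>"
  proof -
    have "s ^ n = s powr real n"
      using s by (simp add: powr_realpow)
    also have "\<dots> = \<bar>det M\<bar> powr (- 1)"
      unfolding s_def powr_powr using n(2) by simp
    finally show ?thesis
      using M by (simp add: powr_minus_divide)
  qed
  have [measurable]: "(*v) M \<in> borel_measurable borel"
    by (intro borel_measurable_continuous_onI matrix_vector_mult_linear_continuous_on)
  let ?B = "cball (0 :: real ^ 'n) 1"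
  have B [measurable]: "?B \<in> sets borel" by simp
  let ?F = "\<lambda>t y. indicator {y. t * norm (M *v y) \<le> 1} y * indicator ?B y :: ennreal"
  let ?G = "\<lambda>t. ennreal V * indicator {0..s} t + ennreal (V * s ^ n / t ^ n) * indicator {s..} t"
  have "(\<integral>\<^sup>+y. ennreal (1 / norm (M *v y)) * indicator ?B y \<partial>lborel)
      \<le> (\<integral>\<^sup>+y. (\<integral>\<^sup>+t. indicator {0..} t * ?F t y \<partial>lborel) \<partial>lborel)"
  proof (rule nn_integral_mono)
    fix y :: "real ^ 'n"
    \<comment> \<open>Only an inequality is available where \<open>M *v y\<close> vanishes: there
      \<open>1 / 0 = 0\<close> on the left, whereas every \<open>t\<close> counts on the
      right.\<close>
    have le: "t * norm (M *v y) \<le> 1" if "0 \<le> t" "t \<le> 1 / norm (M *v y)" for t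
      using that by (cases "M *v y = 0") (auto simp: field_simps)
    have "ennreal (1 / norm (M *v y)) = (\<integral>\<^sup>+t. indicator {0..1 / norm (M *v y)} t \<partial>lborel)"
      by simp
    then have "ennreal (1 / norm (M *v y)) * indicator ?B y
      = (\<integral>\<^sup>+t. indicator {0..1 / norm (M *v y)} t * indicator ?B y \<partial>lborel)"
      by (simp add: nn_integral_multc)
    also have "\<dots> \<le> (\<integral>\<^sup>+t. indicator {0..} t * ?F t y \<partial>lborel)"
      using le by (intro nn_integral_mono) (auto simp: indicator_def)
    finally show "ennreal (1 / norm (M *v y)) * indicator ?B y \<le> \<dots>" .
  qed
  also have "\<dots> = (\<integral>\<^sup>+t. (\<integral>\<^sup>+y. indicator {0..} t * ?F t y \<partial>lborel) \<partial>lborel)"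
    by (rule lborel_pair.Fubini') measurable
  also have "\<dots> \<le> (\<integral>\<^sup>+t. ?G t \<partial>lborel)"
  proof (rule nn_integral_mono)
    fix t :: real
    consider "t < 0" | "0 \<le> t" "t \<le> s" | "s < t" by linarith
    then show "(\<integral>\<^sup>+y. indicator {0..} t * ?F t y \<partial>lborel) \<le> ?G t"
    proof cases
      case 2
      have "(\<integral>\<^sup>+y. indicator {0..} t * ?F t y \<partial>lborel) \<le> (\<integral>\<^sup>+y. indicator ?B y \<partial>lborel)"
        by (intro nn_integral_mono) (auto simp: indicator_def)
      also have "\<dots> = ennreal V"
        by (simp add: emeasure_cball V_def n)
      finally show ?thesis
        using 2 by (auto intro: order_trans)
    next
      case 3
      then have t: "0 < t" using s by simp
      have "(\<integral>\<^sup>+y. indicator {0..} t * ?F t y \<partial>lborel) \<le> (\<integral>\<^sup>+y. indicator {y. norm (M *v y) \<le> 1 / t} y \<partial>lborel)"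
        using t by (intro nn_integral_mono) (auto simp: indicator_def field_simps)
      also have "\<dots> = emeasure lborel {y. norm (M *v y) \<le> 1 / t}"
        by (rule nn_integral_indicator) measurable
      also have "\<dots> = ennreal (V * s ^ n / t ^ n)"
        using t by (subst emeasure_matrix_norm_le[OF M]) (simp_all add: V_def sn[unfolded n(1)] n(1) power_one_over)
      finally show ?thesis
        using 3 by simp
    qed simp
  qed
  also have "\<dots> = ennreal V * ennreal s + (\<integral>\<^sup>+t. ennreal (V * s ^ n / t ^ n) * indicator {s..} t \<partial>lborel)"
    using s by (subst nn_integral_add) (auto simp: nn_integral_cmult)
  also have "(\<integral>\<^sup>+t. ennreal (V * s ^ n / t ^ n) * indicator {s..} t \<partial>lborel)
      = ennreal (0 - (- (V * s ^ n / ((real n - 1) * s ^ (n - 1)))))"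
  proof (rule nn_integral_FTC_atLeast[where F = "\<lambda>t. - (V * s ^ n / ((real n - 1) * t ^ (n - 1)))"])
    fix t assume "s \<le> t"
    then have t: "0 < t" using s by simp
    then show "0 \<le> V * s ^ n / t ^ n" using V s by simp
    obtain m where m: "n = Suc (Suc m)"
      using n(2) by (metis Suc_le_D numeral_2_eq_2 Suc_le_mono)
    \<comment> \<open>Written with \<open>inverse t\<close> and the exponent
      \<open>n - 1 = Suc m\<close>, the antiderivative falls under the power rule.\<close>
    have eq: "(\<lambda>t. - (V * s ^ n / ((real n - 1) * t ^ (n - 1))))
        = (\<lambda>t. - (V * s ^ n / (1 + real m)) * inverse t ^ Suc m)"
      by (rule ext) (simp add: m divide_inverse power_inverse)
    show "((\<lambda>t. - (V * s ^ n / ((real n - 1) * t ^ (n - 1)))) has_real_derivative V * s ^ n / t ^ n) (at t)"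
      unfolding eq
    proof (rule DERIV_cmult[THEN DERIV_cong])
      show "((\<lambda>t. inverse t ^ Suc m) has_real_derivative
          (1 + real m) * (- (inverse t ^ Suc (Suc 0)) * inverse t ^ m)) (at t)"
        using DERIV_power[OF DERIV_inverse[of t], of "Suc m"] t by simp
      show "- (V * s ^ n / (1 + real m)) * ((1 + real m) * (- (inverse t ^ Suc (Suc 0)) * inverse t ^ m))
          = V * s ^ n / t ^ n"
        by (simp add: divide_inverse m power_inverse)
    qed
  next
    have "((\<lambda>t::real. - (V * s ^ n / ((real n - 1) * t ^ (n - 1)))) \<longlongrightarrow> - 0) at_top"
      using n(2)
      by (intro tendsto_minus tendsto_divide_0[OF tendsto_const] filterlim_at_top_imp_at_infinity
            filterlim_tendsto_pos_mult_at_top[OF tendsto_const] filterlim_pow_at_top filterlim_ident) auto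
    then show "((\<lambda>t::real. - (V * s ^ n / ((real n - 1) * t ^ (n - 1)))) \<longlongrightarrow> 0) at_top"
      by simp
  qed simp
  also have "ennreal V * ennreal s + \<dots> = ennreal (real n / (real n - 1) * V * s)"
  proof -
    have "s ^ n = s * s ^ (n - 1)"
      using n(2) by (metis One_nat_def Suc_1 Suc_leD le_0_eq nat.distinct(1) not_gr0 power_minus_mult mult.commute)
    then have "V * s + V * s ^ n / ((real n - 1) * s ^ (n - 1)) = real n / (real n - 1) * V * s"
      using s n(2) by (simp add: field_simps of_nat_diff)
    then show ?thesis
      using V s n(2) by (simp flip: ennreal_mult ennreal_plus)
  qed
  finally show ?thesis
    unfolding V_def s_def .
qed

lemma norm_coords_to_vec:
  assumes "orthonormal_basis_of S B"
  shows "norm (coords_to_vec B f) = sqrt (\<Sum>b\<in>B. (f b)\<^sup>2)"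
proof -
  have "pairwise (\<lambda>a b. orthogonal (f a *\<^sub>R a) (f b *\<^sub>R b)) B"
    using assms by (auto simp: orthonormal_basis_of_def pairwise_def orthogonal_def)
  then have "(norm (coords_to_vec B f))\<^sup>2 = (\<Sum>b\<in>B. (f b)\<^sup>2)"
    using assms unfolding coords_to_vec_def
    by (subst norm_sum_Pythagorean[OF orthonormal_basis_ofD(1)[OF assms]])
       (auto simp: orthonormal_basis_of_def power_mult_distrib intro!: sum.cong)
  then show ?thesis
    by (metis norm_ge_zero real_sqrt_unique)
qed

lemma nn_integral_coords_cball:
  assumes B: "orthonormal_basis_of S B" and r: "0 < r"
  shows "(\<integral>\<^sup>+f. indicator (cball 0 r) (coords_to_vec B f) \<partial>(\<Pi>\<^sub>M b\<in>B. lborel))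
       = ennreal (unit_ball_vol (real (dim S)) * r ^ dim S)"
proof -
  let ?P = "Pi\<^sub>M B (\<lambda>_. lborel :: real measure)"
  have "(\<integral>\<^sup>+f. indicator (cball 0 r) (coords_to_vec B f) \<partial>?P)
      = (\<integral>\<^sup>+f. indicator ({f. sqrt (\<Sum>b\<in>B. (f b)\<^sup>2) \<le> r} \<inter> space ?P) f \<partial>?P)"
    by (intro nn_integral_cong) (auto simp: indicator_def norm_coords_to_vec[OF B])
  also have "\<dots> = emeasure ?P ({f. sqrt (\<Sum>b\<in>B. (f b)\<^sup>2) \<le> r} \<inter> space ?P)"
    by (rule nn_integral_indicator) measurable
  also have "\<dots> = ennreal (unit_ball_vol (real (card B)) * r ^ card B)"
    using orthonormal_basis_ofD[OF B] r by (intro emeasure_cball_aux) auto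
  finally show ?thesis
    by (simp add: orthonormal_basis_ofD(2)[OF B])
qed

lemma subspace_hyperplane_perp: "subspace (hyperplane_perp \<xi>)"
  using subspace_hyperplane[of \<xi>] by (simp add: inner_commute)

lemma dim_hyperplane_perp:
  fixes \<xi> :: "'a::euclidean_space"
  shows "\<xi> \<noteq> 0 \<Longrightarrow> dim (hyperplane_perp \<xi>) = DIM('a) - 1"
  using dim_hyperplane[of \<xi>] by (simp add: inner_commute)

lemma coords_to_vec_perp:
  assumes "orthonormal_basis_of (hyperplane_perp \<xi>) B"
  shows "coords_to_vec B f \<bullet> \<xi> = 0"
  using coords_to_vec_in_span[of B f] assms by (auto simp: orthonormal_basis_of_def)

lemma norm_add_coords_to_vec:
  assumes "orthonormal_basis_of (hyperplane_perp \<xi>) B" and "norm \<xi> = 1"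
  shows "norm (s *\<^sub>R \<xi> + coords_to_vec B f) = sqrt (s\<^sup>2 + (norm (coords_to_vec B f))\<^sup>2)"
proof -
  have "orthogonal (s *\<^sub>R \<xi>) (coords_to_vec B f)"
    using coords_to_vec_perp[OF assms(1), of f] by (simp add: orthogonal_def inner_commute)
  from norm_add_Pythagorean[OF this] assms(2) show ?thesis
    by (simp add: power_mult_distrib real_sqrt_unique)
qed

text \<open>By Pythagoras the intersection contains a cylinder of half-height
  \<open>d = e / norm v\<close> along \<open>v\<close>, over the ball of radius
  \<open>sqrt (1 - d\<^sup>2)\<close> in the hyperplane. The bound is sharp to first order as
  \<open>e\<close> tends to 0.\<close>

lemma emeasure_ball_slab_ge:
  fixes v :: "'a::euclidean_space"
  assumes e: "0 < e" "e < norm v"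
  shows "ennreal (2 * e / norm v * (unit_ball_vol (real (DIM('a) - 1)) * sqrt (1 - (e / norm v)\<^sup>2) ^ (DIM('a) - 1)))
       \<le> emeasure lborel {y \<in> cball 0 1. \<bar>v \<bullet> y\<bar> \<le> e}" (is "?l \<le> emeasure lborel ?S")
proof -
  define d where "d = e / norm v"
  define \<xi> where "\<xi> = v /\<^sub>R norm v"
  let ?r = "sqrt (1 - d\<^sup>2)"
  have v: "v \<noteq> 0" "0 < norm v" using e by auto
  have d: "0 < d" "d < 1" using e v by (auto simp: d_def)
  then have d2: "d\<^sup>2 < 1" by (simp add: power_less_one_iff)
  have \<xi>: "norm \<xi> = 1" "v = norm v *\<^sub>R \<xi>" using v by (auto simp: \<xi>_def)
  obtain B where B: "orthonormal_basis_of (hyperplane_perp \<xi>) B"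
    using orthonormal_basis_of_exists subspace_hyperplane_perp by blast
  have dimB: "dim (hyperplane_perp \<xi>) = DIM('a) - 1"
    using \<xi> by (intro dim_hyperplane_perp) auto
  have S [measurable]: "?S \<in> sets borel"
  proof -
    have "closed ({y. norm y \<le> 1} \<inter> {y. \<bar>v \<bullet> y\<bar> \<le> e})"
      by (intro closed_Int closed_Collect_le continuous_intros)
    also have "{y. norm y \<le> 1} \<inter> {y. \<bar>v \<bullet> y\<bar> \<le> e} = ?S" by auto
    finally show ?thesis by simp
  qed
  have in_slab: "s *\<^sub>R \<xi> + coords_to_vec B f \<in> ?S"
    if "s \<in> {-d..d}" "coords_to_vec B f \<in> cball 0 ?r" for s f
  proof -
    have "\<bar>v \<bullet> (s *\<^sub>R \<xi> + coords_to_vec B f)\<bar> = norm v * \<bar>s\<bar>"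
      using coords_to_vec_perp[OF B, of f] \<xi>
      by (subst \<open>v = norm v *\<^sub>R \<xi>\<close>, unfold inner_scaleR_left)
        (simp add: inner_add_right inner_commute abs_mult norm_eq_1)
    also have "\<dots> \<le> norm v * d"
      using that v by (intro mult_left_mono) auto
    also have "\<dots> = e" using v by (simp add: d_def)
    finally have "\<bar>v \<bullet> (s *\<^sub>R \<xi> + coords_to_vec B f)\<bar> \<le> e" .
    moreover have "s\<^sup>2 \<le> d\<^sup>2"
      using that(1) d by (simp add: abs_le_square_iff[symmetric] abs_le_iff)
    moreover have "(norm (coords_to_vec B f))\<^sup>2 \<le> 1 - d\<^sup>2"
      using that(2) d2 by (auto intro: real_le_rsqrt simp: real_le_rsqrt sqrt_le_D real_sqrt_le_iff
          dest: power_mono[where n = 2])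
    ultimately show ?thesis
      by (simp add: norm_add_coords_to_vec[OF B \<xi>(1)])
  qed
  have [measurable]: "cball (0 :: 'a) ?r \<in> sets borel" by simp
  have "?l = ennreal (2 * d) * ennreal (unit_ball_vol (real (DIM('a) - 1)) * ?r ^ (DIM('a) - 1))"
    using d d2 by (simp add: d_def flip: ennreal_mult)
  also have "\<dots> = (\<integral>\<^sup>+s. indicator {-d..d} s *
      (\<integral>\<^sup>+f. indicator (cball 0 ?r) (coords_to_vec B f) \<partial>(\<Pi>\<^sub>M b\<in>B. lborel)) \<partial>lborel)"
    using d d2 by (subst nn_integral_coords_cball[OF B]) (simp_all add: dimB nn_integral_multc)
  also have "\<dots> = (\<integral>\<^sup>+s. (\<integral>\<^sup>+f. indicator {-d..d} s * indicator (cball 0 ?r) (coords_to_vec B f)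
      \<partial>(\<Pi>\<^sub>M b\<in>B. lborel)) \<partial>lborel)"
    by (intro nn_integral_cong nn_integral_cmult[symmetric]) measurable
  also have "\<dots> \<le> (\<integral>\<^sup>+s. (\<integral>\<^sup>+f. indicator ?S (s *\<^sub>R \<xi> + coords_to_vec B f) \<partial>(\<Pi>\<^sub>M b\<in>B. lborel)) \<partial>lborel)"
    using in_slab by (intro nn_integral_mono) (auto simp: indicator_def)
  also have "\<dots> = (\<integral>\<^sup>+x. indicator ?S x \<partial>lborel)"
    by (rule nn_integral_lborel_hyperplane(2)[OF \<xi>(1) B, symmetric]) measurable
  also have "\<dots> = emeasure lborel ?S" by simp
  finally show ?thesis .
qed

subsection \<open>Sections of an upper semicontinuous density\<close>


lemma limsup_ennreal_mult:
  fixes c :: ennreal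
  assumes "c < top"
  shows "limsup (\<lambda>k. c * f k) = c * limsup f"
  by (rule Limsup_compose_continuous_mono)
    (auto intro!: ennreal_continuous_on_cmult assms monoI mult_left_mono continuous_on_id)

text \<open>What reverse Fatou requires of a density: an integrable majorant, which also works on
  hyperplanes, and upper semicontinuity in sequential form. A continuous density on a compact set
  keeps both after extension by 0.\<close>

locale usc_density =
  fixes h :: "'a::euclidean_space \<Rightarrow> ennreal" and M R :: real
  assumes borel [measurable]: "h \<in> borel_measurable borel"
    and bounds: "0 < M" "0 < R"
    and bound: "\<And>x. h x \<le> ennreal M * indicator (cball 0 R) x"
    and usc: "\<And>X x. X \<longlonglongrightarrow> x \<Longrightarrow> limsup (\<lambda>k::nat. h (X k)) \<le> h x"
begin

definition slice :: "'a \<Rightarrow> ennreal" where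
  "slice \<xi> = (\<integral>\<^sup>+x. h x \<partial>lborel_subspace (hyperplane_perp \<xi>))"

lemma slice_eq_coords:
  assumes "orthonormal_basis_of (hyperplane_perp \<xi>) B"
  shows "slice \<xi> = (\<integral>\<^sup>+f. h (coords_to_vec B f) \<partial>(\<Pi>\<^sub>M b\<in>B. lborel))"
  unfolding slice_def lborel_subspace_eq[OF assms] by (rule nn_integral_distr) auto

text \<open>The majorant depends on the coordinates \<open>f\<close> and not on the point
  \<open>x\<close>, so one function dominates a whole sequence of evaluation points.\<close>

lemma bound_coords:
  assumes "norm (coords_to_vec B f) \<le> norm x"
  shows "h x \<le> ennreal M * indicator (cball 0 R) (coords_to_vec B f)"
proof -
  have "(indicator (cball 0 R) x :: ennreal) \<le> indicator (cball 0 R) (coords_to_vec B f)"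
    using assms by (auto simp: indicator_def)
  with bound[of x] show ?thesis
    by (meson mult_left_mono order_trans zero_le)
qed

lemma indicator_cball_coords_measurable [measurable]:
  "(\<lambda>f. indicator (cball 0 r) (coords_to_vec B f) :: ennreal) \<in> borel_measurable (\<Pi>\<^sub>M b\<in>B. lborel)"
  by (rule measurable_compose[OF coords_to_vec_measurable])
    (intro borel_measurable_indicator borel_closed closed_cball)

lemma nn_integral_bound_coords:
  assumes "orthonormal_basis_of S B"
  shows "(\<integral>\<^sup>+f. ennreal M * indicator (cball 0 R) (coords_to_vec B f) \<partial>(\<Pi>\<^sub>M b\<in>B. lborel))
       = ennreal (M * (unit_ball_vol (real (dim S)) * R ^ dim S))"
proof -
  have "(\<integral>\<^sup>+f. ennreal M * indicator (cball 0 R) (coords_to_vec B f) \<partial>(\<Pi>\<^sub>M b\<in>B. lborel))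
      = ennreal M * (\<integral>\<^sup>+f. indicator (cball 0 R) (coords_to_vec B f) \<partial>(\<Pi>\<^sub>M b\<in>B. lborel))"
    by (rule nn_integral_cmult) (rule indicator_cball_coords_measurable)
  then show ?thesis
    using nn_integral_coords_cball[OF assms bounds(2)] bounds by (simp add: ennreal_mult)
qed

lemma nn_integral_coords_le:
  assumes B: "orthonormal_basis_of S B"
    and norm: "\<And>f. norm (coords_to_vec B f) \<le> norm (X f)"
  shows "(\<integral>\<^sup>+f. h (X f) \<partial>(\<Pi>\<^sub>M b\<in>B. lborel)) \<le> ennreal (M * (unit_ball_vol (real (dim S)) * R ^ dim S))"
  unfolding nn_integral_bound_coords[OF B, symmetric]
  by (intro nn_integral_mono bound_coords norm)

text \<open>Reverse Fatou followed by pointwise semicontinuity. The norm condition holds both for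
  points displaced orthogonally to the hyperplane and for rotated points, which are the two
  applications.\<close>

lemma limsup_nn_integral_coords_le:
  assumes B: "orthonormal_basis_of S B"
    and X [measurable]: "\<And>k. X k \<in> borel_measurable (\<Pi>\<^sub>M b\<in>B. lborel)"
    and norm: "\<And>k f. norm (coords_to_vec B f) \<le> norm (X k f)"
    and lim: "\<And>f. (\<lambda>k. X k f) \<longlonglongrightarrow> Y f"
  shows "limsup (\<lambda>k. \<integral>\<^sup>+f. h (X k f) \<partial>(\<Pi>\<^sub>M b\<in>B. lborel)) \<le> (\<integral>\<^sup>+f. h (Y f) \<partial>(\<Pi>\<^sub>M b\<in>B. lborel))"
proof -
  have "limsup (\<lambda>k. \<integral>\<^sup>+f. h (X k f) \<partial>(\<Pi>\<^sub>M b\<in>B. lborel))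
      \<le> (\<integral>\<^sup>+f. limsup (\<lambda>k. h (X k f)) \<partial>(\<Pi>\<^sub>M b\<in>B. lborel))"
  proof (rule nn_integral_limsup[where w = "\<lambda>f. ennreal M * indicator (cball 0 R) (coords_to_vec B f)"])
    show "AE f in \<Pi>\<^sub>M b\<in>B. lborel. h (X k f) \<le> ennreal M * indicator (cball 0 R) (coords_to_vec B f)" for k
      by (intro AE_I2 bound_coords norm)
    show "(\<lambda>f. ennreal M * indicator (cball 0 R) (coords_to_vec B f)) \<in> borel_measurable (\<Pi>\<^sub>M b\<in>B. lborel)"
      by (intro borel_measurable_times_ennreal borel_measurable_const indicator_cball_coords_measurable)
  qed (simp_all add: nn_integral_bound_coords[OF B])
  also have "\<dots> \<le> (\<integral>\<^sup>+f. h (Y f) \<partial>(\<Pi>\<^sub>M b\<in>B. lborel))"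
    by (intro nn_integral_mono usc lim)
  finally show ?thesis .
qed

text \<open>The normalisation is by \<open>2 * e\<close>, although the slab has width
  \<open>2 * e / norm v\<close>; this leaves a factor \<open>1 / norm v\<close> in the
  limit.\<close>

definition slab_mean :: "'a \<Rightarrow> real \<Rightarrow> ennreal" where
  "slab_mean v e = ennreal (1 / (2 * e)) * (\<integral>\<^sup>+x. h x * indicator {x. \<bar>x \<bullet> v\<bar> \<le> e} x \<partial>lborel)"

text \<open>Slicing parallel to the hyperplane and substituting \<open>s = e * t\<close> fixes the
  domain of integration, so that \<open>e\<close> occurs only in the integrand.\<close>

lemma slab_mean_unit:
  assumes \<xi>: "norm \<xi> = 1" and B: "orthonormal_basis_of (hyperplane_perp \<xi>) B" and e: "0 < e"
  shows "slab_mean \<xi> e = ennreal (1 / 2) * (\<integral>\<^sup>+t.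
     (\<integral>\<^sup>+f. h ((e * t) *\<^sub>R \<xi> + coords_to_vec B f) \<partial>(\<Pi>\<^sub>M b\<in>B. lborel)) * indicator {-1..1} t \<partial>lborel)"
proof -
  let ?P = "Pi\<^sub>M B (\<lambda>_. lborel :: real measure)"
  interpret product_sigma_finite "\<lambda>_::'a. lborel :: real measure" ..
  interpret P: sigma_finite_measure ?P by (rule sigma_finite) (rule orthonormal_basis_ofD[OF B])
  let ?\<Phi> = "\<lambda>s. \<integral>\<^sup>+f. h (s *\<^sub>R \<xi> + coords_to_vec B f) \<partial>?P"
  have [measurable]: "{x. \<bar>x \<bullet> \<xi>\<bar> \<le> e} \<in> sets borel" by measurable
  have coord: "(s *\<^sub>R \<xi> + coords_to_vec B f) \<bullet> \<xi> = s" for s f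
    using \<xi> coords_to_vec_perp[OF B, of f] by (simp add: inner_add_left norm_eq_1)
  have "(\<integral>\<^sup>+x. h x * indicator {x. \<bar>x \<bullet> \<xi>\<bar> \<le> e} x \<partial>lborel)
      = (\<integral>\<^sup>+s. (\<integral>\<^sup>+f. h (s *\<^sub>R \<xi> + coords_to_vec B f)
          * indicator {x. \<bar>x \<bullet> \<xi>\<bar> \<le> e} (s *\<^sub>R \<xi> + coords_to_vec B f) \<partial>?P) \<partial>lborel)"
    by (rule nn_integral_lborel_hyperplane(2)[OF \<xi> B]) measurable
  also have "\<dots> = (\<integral>\<^sup>+s. (\<integral>\<^sup>+f. h (s *\<^sub>R \<xi> + coords_to_vec B f) * indicator {-e..e} s \<partial>?P) \<partial>lborel)"
    by (intro nn_integral_cong) (auto simp: coord indicator_def abs_le_iff)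
  also have "\<dots> = (\<integral>\<^sup>+s. ?\<Phi> s * indicator {-e..e} s \<partial>lborel)"
    by (intro nn_integral_cong nn_integral_multc) measurable
  also have "\<dots> = ennreal \<bar>e\<bar> * (\<integral>\<^sup>+t. ?\<Phi> (0 + e * t) * indicator {-e..e} (0 + e * t) \<partial>lborel)"
    using e by (intro nn_integral_real_affine) measurable
  also have "(\<integral>\<^sup>+t. ?\<Phi> (0 + e * t) * indicator {-e..e} (0 + e * t) \<partial>lborel)
      = (\<integral>\<^sup>+t. ?\<Phi> (e * t) * indicator {-1..1} t \<partial>lborel)"
  proof (rule nn_integral_cong)
    fix t :: real
    have "- e \<le> e * t \<longleftrightarrow> -1 \<le> t" "e * t \<le> e \<longleftrightarrow> t \<le> 1"
      using e mult_le_cancel_left_pos[of e "-1" t] mult_le_cancel_left_pos[of e t 1] by auto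
    then show "?\<Phi> (0 + e * t) * indicator {-e..e} (0 + e * t) = ?\<Phi> (e * t) * indicator {-1..1} t"
      by (simp add: indicator_def)
  qed
  finally show ?thesis
    using e by (simp add: slab_mean_def mult.assoc[symmetric] flip: ennreal_mult)
qed

text \<open>Every parallel section is dominated by \<open>M\<close> on a ball of radius
  \<open>R\<close> in the hyperplane. Uniformity in \<open>e\<close> and \<open>\<xi>\<close> is
  what later provides the majorant as a function of \<open>y\<close>.\<close>

lemma slab_mean_unit_le:
  assumes \<xi>: "norm \<xi> = 1" and e: "0 < e"
  shows "slab_mean \<xi> e \<le> ennreal (M * (unit_ball_vol (real (DIM('a) - 1)) * R ^ (DIM('a) - 1)))"
proof -
  obtain B where B: "orthonormal_basis_of (hyperplane_perp \<xi>) B"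
    using orthonormal_basis_of_exists subspace_hyperplane_perp by blast
  let ?C = "ennreal (M * (unit_ball_vol (real (DIM('a) - 1)) * R ^ (DIM('a) - 1)))"
  have "\<xi> \<noteq> 0" using \<xi> by auto
  then have "(\<integral>\<^sup>+f. h (s *\<^sub>R \<xi> + coords_to_vec B f) \<partial>(\<Pi>\<^sub>M b\<in>B. lborel)) \<le> ?C" for s
    using nn_integral_coords_le[OF B, of "\<lambda>f. s *\<^sub>R \<xi> + coords_to_vec B f"]
    by (simp add: dim_hyperplane_perp norm_add_coords_to_vec[OF B \<xi>] real_le_rsqrt)
  then have "(\<integral>\<^sup>+t. (\<integral>\<^sup>+f. h ((e * t) *\<^sub>R \<xi> + coords_to_vec B f) \<partial>(\<Pi>\<^sub>M b\<in>B. lborel)) * indicator {-1..1} t \<partial>lborel)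
      \<le> (\<integral>\<^sup>+t. ?C * indicator {-1..1::real} t \<partial>lborel)"
    by (intro nn_integral_mono mult_right_mono) auto
  also have "\<dots> = ?C * ennreal 2"
    by (subst nn_integral_cmult) auto
  finally have "slab_mean \<xi> e \<le> ennreal (1 / 2) * (?C * ennreal 2)"
    unfolding slab_mean_unit[OF \<xi> B e] by (intro mult_left_mono) auto
  also have "\<dots> = ?C * (ennreal (1 / 2) * ennreal 2)"
    by (simp only: mult_ac)
  also have "ennreal (1 / 2) * ennreal 2 = 1"
    by (subst ennreal_mult[symmetric]) auto
  finally show ?thesis by simp
qed

text \<open>Reverse Fatou is used twice: within the hyperplane, where the section at height
  \<open>e k * t\<close> approaches the central one, and then in \<open>t\<close> over the interval
  from -1 to 1, whose length cancels the factor 1/2.\<close>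

lemma limsup_slab_mean_unit_le:
  assumes \<xi>: "norm \<xi> = 1" and e: "\<And>k. 0 < e k" "e \<longlonglongrightarrow> 0"
  shows "limsup (\<lambda>k. slab_mean \<xi> (e k)) \<le> slice \<xi>"
proof -
  obtain B where B: "orthonormal_basis_of (hyperplane_perp \<xi>) B"
    using orthonormal_basis_of_exists subspace_hyperplane_perp by blast
  let ?P = "Pi\<^sub>M B (\<lambda>_. lborel :: real measure)"
  interpret product_sigma_finite "\<lambda>_::'a. lborel :: real measure" ..
  interpret P: sigma_finite_measure ?P by (rule sigma_finite) (rule orthonormal_basis_ofD[OF B])
  let ?\<Phi> = "\<lambda>s. \<integral>\<^sup>+f. h (s *\<^sub>R \<xi> + coords_to_vec B f) \<partial>?P"
  let ?C = "ennreal (M * (unit_ball_vol (real (DIM('a) - 1)) * R ^ (DIM('a) - 1)))"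
  have \<xi>0: "\<xi> \<noteq> 0" using \<xi> by auto
  have C: "?\<Phi> s \<le> ?C" for s
    using nn_integral_coords_le[OF B, of "\<lambda>f. s *\<^sub>R \<xi> + coords_to_vec B f"] \<xi>0
    by (simp add: dim_hyperplane_perp norm_add_coords_to_vec[OF B \<xi>] real_le_rsqrt)
  have [measurable]: "(\<lambda>t. ?\<Phi> (e k * t)) \<in> borel_measurable borel" for k
    by measurable
  have lim: "limsup (\<lambda>k. ?\<Phi> (e k * t)) \<le> slice \<xi>" for t
  proof -
    have "limsup (\<lambda>k. ?\<Phi> (e k * t)) \<le> (\<integral>\<^sup>+f. h (coords_to_vec B f) \<partial>?P)"
    proof (rule limsup_nn_integral_coords_le[OF B])
      show "norm (coords_to_vec B f) \<le> norm ((e k * t) *\<^sub>R \<xi> + coords_to_vec B f)" for k f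
        by (simp add: norm_add_coords_to_vec[OF B \<xi>] real_le_rsqrt)
      have "(\<lambda>k. (e k * t) *\<^sub>R \<xi> + coords_to_vec B f) \<longlonglongrightarrow> (0 * t) *\<^sub>R \<xi> + coords_to_vec B f" for f
        by (intro tendsto_intros e)
      then show "(\<lambda>k. (e k * t) *\<^sub>R \<xi> + coords_to_vec B f) \<longlonglongrightarrow> coords_to_vec B f" for f
        by simp
    qed measurable
    then show ?thesis
      by (simp add: slice_eq_coords[OF B])
  qed
  have "limsup (\<lambda>k. \<integral>\<^sup>+t. ?\<Phi> (e k * t) * indicator {-1..1} t \<partial>lborel)
      \<le> (\<integral>\<^sup>+t. limsup (\<lambda>k. ?\<Phi> (e k * t) * indicator {-1..1} t) \<partial>lborel)"
  proof (rule nn_integral_limsup[where w = "\<lambda>t. ?C * indicator {-1..1} t"])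
    show "AE t in lborel. ?\<Phi> (e k * t) * indicator {-1..1} t \<le> ?C * indicator {-1..1} t" for k
      by (intro AE_I2 mult_right_mono C) auto
    have "(\<integral>\<^sup>+t. ?C * indicator {-1..1::real} t \<partial>lborel) = ?C * ennreal 2"
      by (subst nn_integral_cmult) auto
    then show "(\<integral>\<^sup>+t. ?C * indicator {-1..1::real} t \<partial>lborel) < \<infinity>"
      by (simp only:) (auto simp: ennreal_mult_less_top)
  qed measurable
  also have "\<dots> \<le> (\<integral>\<^sup>+t. slice \<xi> * indicator {-1..1::real} t \<partial>lborel)"
    using lim by (intro nn_integral_mono) (auto simp: indicator_def Limsup_const)
  also have "\<dots> = slice \<xi> * ennreal 2"
    by (subst nn_integral_cmult) auto
  finally have *: "limsup (\<lambda>k. \<integral>\<^sup>+t. ?\<Phi> (e k * t) * indicator {-1..1} t \<partial>lborel) \<le> slice \<xi> * ennreal 2" .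
  have "limsup (\<lambda>k. slab_mean \<xi> (e k))
      = ennreal (1 / 2) * limsup (\<lambda>k. \<integral>\<^sup>+t. ?\<Phi> (e k * t) * indicator {-1..1} t \<partial>lborel)"
    unfolding slab_mean_unit[OF \<xi> B e(1)] by (rule limsup_ennreal_mult[OF ennreal_less_top])
  also have "\<dots> \<le> ennreal (1 / 2) * (slice \<xi> * ennreal 2)"
    by (intro mult_left_mono *) auto
  also have "\<dots> = slice \<xi> * (ennreal (1 / 2) * ennreal 2)"
    by (simp only: mult_ac)
  also have "ennreal (1 / 2) * ennreal 2 = 1"
    by (subst ennreal_mult[symmetric]) auto
  finally show ?thesis by simp
qed

text \<open>The same slab has unit normal \<open>v /\<^sub>R norm v\<close> and half-width
  \<open>e / norm v\<close>; only the normalising factor changes.\<close>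

lemma slab_mean_scale:
  assumes v: "v \<noteq> 0" and e: "0 < e"
  shows "slab_mean v e = ennreal (1 / norm v) * slab_mean (v /\<^sub>R norm v) (e / norm v)"
proof -
  have "{x. \<bar>x \<bullet> v\<bar> \<le> e} = {x. \<bar>x \<bullet> (v /\<^sub>R norm v)\<bar> \<le> e / norm v}"
    using v by (auto simp: abs_mult field_simps)
  then show ?thesis
    using v e by (simp add: slab_mean_def mult.assoc[symmetric] flip: ennreal_mult)
qed

lemma slab_mean_le:
  assumes "v \<noteq> 0" "0 < e"
  shows "slab_mean v e \<le> ennreal (1 / norm v) * ennreal (M * (unit_ball_vol (real (DIM('a) - 1)) * R ^ (DIM('a) - 1)))"
  unfolding slab_mean_scale[OF assms]
  using assms by (intro mult_left_mono slab_mean_unit_le) auto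

lemma limsup_slab_mean_le:
  assumes v: "v \<noteq> 0" and e: "\<And>k. 0 < e k" "e \<longlonglongrightarrow> 0"
  shows "limsup (\<lambda>k. slab_mean v (e k)) \<le> ennreal (1 / norm v) * slice (v /\<^sub>R norm v)"
proof -
  have "(\<lambda>k. e k / norm v) \<longlonglongrightarrow> 0 / norm v"
    using v by (intro tendsto_intros e) auto
  then have "limsup (\<lambda>k. slab_mean (v /\<^sub>R norm v) (e k / norm v)) \<le> slice (v /\<^sub>R norm v)"
    using v e by (intro limsup_slab_mean_unit_le) auto
  then show ?thesis
    unfolding slab_mean_scale[OF v e(1)] by (subst limsup_ennreal_mult) (auto intro: mult_left_mono)
qed

end


section \<open>Rotated sections and attainment of the maximum\<close>

lemma orthonormal_basis_of_rotated_perp: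
  fixes Q :: "real ^ 'n ^ 'n"
  assumes Q: "orthogonal_matrix Q" and B: "orthonormal_basis_of (hyperplane_perp e) B"
  shows "orthonormal_basis_of (hyperplane_perp (Q *v e)) ((*v) Q ` B)"
proof -
  have o: "orthogonal_transformation ((*v) Q)"
    using Q by (simp add: orthogonal_transformation_matrix)
  then have in_eq: "(Q *v x) \<bullet> (Q *v e) = x \<bullet> e" for x
    by (simp add: orthogonal_transformation_def)
  have "hyperplane_perp (Q *v e) = (*v) Q ` hyperplane_perp e"
  proof (intro equalityI subsetI)
    fix x assume x: "x \<in> hyperplane_perp (Q *v e)"
    obtain y where "x = Q *v y"
      using orthogonal_transformation_surj[OF o] by (metis surjD)
    with x show "x \<in> (*v) Q ` hyperplane_perp e"
      using in_eq by auto
  qed (auto simp: in_eq)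
  then show ?thesis
    using orthogonal_transformation_orthonormal_basis[OF o B] by simp
qed

lemma compact_orthogonal_matrices: "compact {Q :: real ^ 'n ^ 'n. orthogonal_matrix Q}"
proof -
  have "bounded {Q :: real ^ 'n ^ 'n. \<forall>x\<in>ball 0 1. norm (Q *v x) \<le> 1}"
    by (rule bounded_matrices_norm_le[of 1]) auto
  moreover have "norm (Q *v x) = norm x" if "orthogonal_matrix Q" for Q :: "real ^ 'n ^ 'n" and x
    using that by (intro orthogonal_transformation_norm) (simp add: orthogonal_transformation_matrix)
  ultimately have "bounded {Q :: real ^ 'n ^ 'n. orthogonal_matrix Q}"
    by (elim bounded_subset) auto
  moreover have "closed {Q :: real ^ 'n ^ 'n. transpose Q ** Q = mat 1}"
    unfolding transpose_def matrix_matrix_mult_def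
    by (intro closed_Collect_eq continuous_intros)
  ultimately show ?thesis
    by (simp add: compact_eq_bounded_closed orthogonal_matrix)
qed

text \<open>Sections in different directions lie on different hyperplanes. Writing each direction as
  a rotation of one axis makes all of them integrals over the coordinates of a single basis, where
  \<open>limsup_nn_integral_coords_le\<close> applies. Compactness of the orthogonal group then
  provides the limit rotation.\<close>

lemma slice_attains_max:
  fixes h :: "real ^ 'n \<Rightarrow> ennreal"
  assumes "usc_density h M R"
  obtains \<xi> where "norm \<xi> = 1" "\<And>\<eta>. norm \<eta> = 1 \<Longrightarrow> usc_density.slice h \<eta> \<le> usc_density.slice h \<xi>"
proof -
  interpret usc_density h M R by fact
  fix k :: 'n
  let ?e = "axis k 1 :: real ^ 'n"
  obtain B where B: "orthonormal_basis_of (hyperplane_perp ?e) B"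
    using orthonormal_basis_of_exists subspace_hyperplane_perp by blast
  have slice_rot: "slice (Q *v ?e) = (\<integral>\<^sup>+f. h (Q *v coords_to_vec B f) \<partial>(\<Pi>\<^sub>M b\<in>B. lborel))"
    if "orthogonal_matrix Q" for Q :: "real ^ 'n ^ 'n"
  proof -
    have "orthogonal_transformation ((*v) Q)"
      using that by (simp add: orthogonal_transformation_matrix)
    then show ?thesis
      unfolding slice_eq_coords[OF orthonormal_basis_of_rotated_perp[OF that B]]
      by (rule nn_integral_coords_orthogonal[OF _ orthonormal_basis_ofD(1)[OF B] borel])
  qed
  have norm_rot: "norm (Q *v x) = norm x" if "orthogonal_matrix Q" for Q :: "real ^ 'n ^ 'n" and x
    using that by (intro orthogonal_transformation_norm) (simp add: orthogonal_transformation_matrix)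
  have "?e \<in> sphere 0 1" by simp
  then have "slice ` sphere 0 1 \<noteq> {}" by blast
  \<comment> \<open>A maximising sequence chosen increasing, so that its values converge to the
    supremum along every subsequence.\<close>
  then obtain u where u: "incseq u" "range u \<subseteq> slice ` sphere 0 1" "Sup (slice ` sphere 0 1) = (SUP i. u i)"
    using ennreal_Sup_countable_SUP[of "slice ` sphere 0 1"] by metis
  have "\<exists>Q. orthogonal_matrix Q \<and> u i = slice (Q *v ?e)" for i
  proof -
    have "u i \<in> slice ` sphere 0 1"
      using u(2) by auto
    then obtain \<eta> where \<eta>: "\<eta> \<in> sphere 0 1" "u i = slice \<eta>"
      by (rule imageE) blast
    then obtain Q where "orthogonal_matrix Q" "Q *v ?e = \<eta>"
      using orthogonal_matrix_exists_basis[of \<eta> k] by auto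
    with \<eta>(2) show ?thesis by blast
  qed
  then obtain Q where Q: "\<And>i. orthogonal_matrix (Q i)" "\<And>i. u i = slice (Q i *v ?e)"
    by metis
  obtain P r where P: "orthogonal_matrix P" and r: "strict_mono r" "(Q \<circ> r) \<longlonglongrightarrow> P"
    using compact_orthogonal_matrices[unfolded compact_def, rule_format, of Q] Q(1) by auto
  have "(\<lambda>i. u (r i)) \<longlonglongrightarrow> Sup (slice ` sphere 0 1)"
    using LIMSEQ_subseq_LIMSEQ[OF LIMSEQ_SUP[OF u(1)] r(1)] by (simp add: u(3) o_def)
  then have "Sup (slice ` sphere 0 1) = limsup (\<lambda>i. u (r i))"
    by (simp add: lim_imp_Limsup)
  also have "\<dots> = limsup (\<lambda>i. \<integral>\<^sup>+f. h (Q (r i) *v coords_to_vec B f) \<partial>(\<Pi>\<^sub>M b\<in>B. lborel))"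
    by (simp add: Q(2) slice_rot[OF Q(1)])
  also have "\<dots> \<le> (\<integral>\<^sup>+f. h (P *v coords_to_vec B f) \<partial>(\<Pi>\<^sub>M b\<in>B. lborel))"
  proof (rule limsup_nn_integral_coords_le[OF B])
    fix i
    show "(\<lambda>f. Q (r i) *v coords_to_vec B f) \<in> borel_measurable (\<Pi>\<^sub>M b\<in>B. lborel)"
      by (rule measurable_compose[OF coords_to_vec_measurable])
        (intro borel_measurable_continuous_onI matrix_vector_mult_linear_continuous_on)
  next
    fix f
    have "continuous_on UNIV (\<lambda>A :: real ^ 'n ^ 'n. A *v coords_to_vec B f)"
      unfolding matrix_vector_mult_def by (intro continuous_intros)
    from continuous_on_tendsto_compose[OF this r(2)]
    show "(\<lambda>i. Q (r i) *v coords_to_vec B f) \<longlonglongrightarrow> P *v coords_to_vec B f"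
      by (simp add: o_def)
  qed (simp add: norm_rot[OF Q(1)])
  also have "\<dots> = slice (P *v ?e)"
    by (rule slice_rot[OF P, symmetric])
  finally have max: "Sup (slice ` sphere 0 1) \<le> slice (P *v ?e)" .
  show thesis
  proof
    show "norm (P *v ?e) = 1"
      by (simp add: norm_rot[OF P])
    fix \<eta> :: "real ^ 'n" assume "norm \<eta> = 1"
    then have "slice \<eta> \<le> Sup (slice ` sphere 0 1)"
      by (intro Sup_upper) auto
    with max show "slice \<eta> \<le> slice (P *v ?e)" by simp
  qed
qed

section \<open>Double integral over points and slabs\<close>

lemma liminf_ball_slab_ge:
  fixes v :: "'a::euclidean_space"
  assumes v: "0 < norm v" "norm v \<le> 1" and e: "\<And>k. 0 < e k" "e \<longlonglongrightarrow> 0"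
  shows "ennreal (unit_ball_vol (real (DIM('a) - 1)))
       \<le> liminf (\<lambda>k. ennreal (1 / (2 * e k)) * emeasure lborel {y \<in> cball 0 1. \<bar>v \<bullet> y\<bar> \<le> e k})"
    (is "ennreal ?V \<le> liminf ?J")
proof -
  let ?b = "\<lambda>k. 1 / norm v * (?V * sqrt (1 - (e k / norm v)\<^sup>2) ^ (DIM('a) - 1))"
  have "?b \<longlonglongrightarrow> 1 / norm v * (?V * sqrt (1 - (0 / norm v)\<^sup>2) ^ (DIM('a) - 1))"
    using v by (intro tendsto_intros e) auto
  then have b: "(\<lambda>k. ennreal (?b k)) \<longlonglongrightarrow> ennreal (?V / norm v)"
    by (intro tendsto_ennrealI) simp
  \<comment> \<open>The only use of \<open>norm v \<le> 1\<close>: the factor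
    \<open>1 / norm v\<close> in the limit is dropped.\<close>
  have "?V \<le> ?V / norm v"
    using v by (simp add: field_simps)
  then have "ennreal ?V \<le> ennreal (?V / norm v)"
    by (rule ennreal_leI)
  also have "\<dots> = liminf (\<lambda>k. ennreal (?b k))"
    using b by (simp add: lim_imp_Liminf)
  also have "\<dots> \<le> liminf ?J"
  proof (rule Liminf_mono)
    \<comment> \<open>The cylinder estimate requires the half-width to be below
      \<open>norm v\<close>.\<close>
    have "eventually (\<lambda>k. e k < norm v) sequentially"
      by (rule order_tendstoD(2)[OF e(2) v(1)])
    then show "eventually (\<lambda>k. ennreal (?b k) \<le> ?J k) sequentially"
    proof eventually_elim
      case (elim k)
      have "ennreal (?b k) = ennreal (1 / (2 * e k)) * ennreal (2 * e k / norm v *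
          (?V * sqrt (1 - (e k / norm v)\<^sup>2) ^ (DIM('a) - 1)))"
        using e(1)[of k] by (subst ennreal_mult'[symmetric]) (auto simp: field_simps)
      also have "\<dots> \<le> ?J k"
        by (intro mult_left_mono emeasure_ball_slab_ge e elim) auto
      finally show ?case .
    qed
  qed
  finally show ?thesis .
qed

text \<open>Tonelli, with the slab condition on \<open>y\<close> read through the adjoint as a slab
  condition on \<open>x\<close> with normal \<open>T y\<close>. The measurability claims serve Fatou
  and reverse Fatou.\<close>

lemma (in usc_density) nn_integral_slab_swap:
  fixes S T :: "'a \<Rightarrow> 'a"
  assumes adj: "\<And>x y. S x \<bullet> y = x \<bullet> T y" and [measurable]: "S \<in> borel_measurable borel"
  shows "(\<integral>\<^sup>+x. h x * (ennreal (1 / (2 * e)) * emeasure lborel {y \<in> cball 0 1. \<bar>S x \<bullet> y\<bar> \<le> e}) \<partial>lborel)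
       = (\<integral>\<^sup>+y. slab_mean (T y) e * indicator (cball 0 1) y \<partial>lborel)"
    and "(\<lambda>x. h x * (ennreal (1 / (2 * e)) * emeasure lborel {y \<in> cball 0 1. \<bar>S x \<bullet> y\<bar> \<le> e}))
       \<in> borel_measurable borel"
    and "(\<lambda>y. slab_mean (T y) e * indicator (cball 0 1) y) \<in> borel_measurable borel"
proof -
  let ?c = "ennreal (1 / (2 * e))"
  \<comment> \<open>Composing a real indicator with the inner product makes joint measurability in
    \<open>x\<close> and \<open>y\<close> evident.\<close>
  let ?I = "\<lambda>x y. indicator {..e} \<bar>S x \<bullet> y\<bar> :: ennreal"
  have [measurable]: "cball (0::'a) 1 \<in> sets borel" by simp
  have sets: "{y \<in> cball 0 1. \<bar>S x \<bullet> y\<bar> \<le> e} \<in> sets borel" for x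
  proof -
    have "closed (cball 0 1 \<inter> {y. \<bar>S x \<bullet> y\<bar> \<le> e})"
      by (intro closed_Int closed_cball closed_Collect_le continuous_intros)
    also have "cball 0 1 \<inter> {y. \<bar>S x \<bullet> y\<bar> \<le> e} = {y \<in> cball 0 1. \<bar>S x \<bullet> y\<bar> \<le> e}" by auto
    finally show ?thesis by simp
  qed
  have em: "emeasure lborel {y \<in> cball 0 1. \<bar>S x \<bullet> y\<bar> \<le> e} = (\<integral>\<^sup>+y. ?I x y * indicator (cball 0 1) y \<partial>lborel)" for x
  proof -
    have "emeasure lborel {y \<in> cball 0 1. \<bar>S x \<bullet> y\<bar> \<le> e}
        = (\<integral>\<^sup>+y. indicator {y \<in> cball 0 1. \<bar>S x \<bullet> y\<bar> \<le> e} y \<partial>lborel)"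
      using sets by simp
    also have "\<dots> = (\<integral>\<^sup>+y. ?I x y * indicator (cball 0 1) y \<partial>lborel)"
      by (intro nn_integral_cong) (auto simp: indicator_def)
    finally show ?thesis .
  qed
  have sm: "slab_mean (T y) e = ?c * (\<integral>\<^sup>+x. h x * ?I x y \<partial>lborel)" for y
    unfolding slab_mean_def
    by (intro arg_cong[of _ _ "\<lambda>t. ?c * t"] nn_integral_cong) (auto simp: indicator_def adj)
  show "(\<lambda>x. h x * (?c * emeasure lborel {y \<in> cball 0 1. \<bar>S x \<bullet> y\<bar> \<le> e})) \<in> borel_measurable borel"
    unfolding em by measurable
  show "(\<lambda>y. slab_mean (T y) e * indicator (cball 0 1) y) \<in> borel_measurable borel"
    unfolding sm by measurable
  have "(\<integral>\<^sup>+x. h x * (?c * emeasure lborel {y \<in> cball 0 1. \<bar>S x \<bullet> y\<bar> \<le> e}) \<partial>lborel)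
      = (\<integral>\<^sup>+x. (\<integral>\<^sup>+y. h x * (?c * (?I x y * indicator (cball 0 1) y)) \<partial>lborel) \<partial>lborel)"
    unfolding em by (intro nn_integral_cong) (simp add: nn_integral_cmult)
  also have "\<dots> = (\<integral>\<^sup>+y. (\<integral>\<^sup>+x. h x * (?c * (?I x y * indicator (cball 0 1) y)) \<partial>lborel) \<partial>lborel)"
    by (rule lborel_pair.Fubini') measurable
  also have "\<dots> = (\<integral>\<^sup>+y. (\<integral>\<^sup>+x. ?c * (h x * ?I x y) * indicator (cball 0 1) y \<partial>lborel) \<partial>lborel)"
    by (simp only: mult_ac)
  also have "\<dots> = (\<integral>\<^sup>+y. slab_mean (T y) e * indicator (cball 0 1) y \<partial>lborel)"
    unfolding sm by (intro nn_integral_cong) (simp add: nn_integral_cmult nn_integral_multc)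
  finally show "(\<integral>\<^sup>+x. h x * (?c * emeasure lborel {y \<in> cball 0 1. \<bar>S x \<bullet> y\<bar> \<le> e}) \<partial>lborel)
      = (\<integral>\<^sup>+y. slab_mean (T y) e * indicator (cball 0 1) y \<partial>lborel)" .
qed

text \<open>This holds for any invertible \<open>A\<close> mapping the support of \<open>h\<close>
  into the unit ball; John's position serves only to bound the determinant afterwards.\<close>

lemma nn_integral_le_slice_bound:
  fixes h :: "real ^ 'n \<Rightarrow> ennreal" and A :: "real ^ 'n ^ 'n"
  assumes "usc_density h M R" and n: "n = CARD('n)" "2 \<le> n"
    and A: "det A \<noteq> 0" and supp: "\<And>x. h x \<noteq> 0 \<Longrightarrow> norm (A *v x) \<le> 1"
    and m: "\<And>\<xi>. norm \<xi> = 1 \<Longrightarrow> usc_density.slice h \<xi> \<le> m"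
  shows "ennreal (unit_ball_vol (real n - 1)) * (\<integral>\<^sup>+x. h x \<partial>lborel)
       \<le> ennreal (real n / (real n - 1) * unit_ball_vol (real n) * \<bar>det A\<bar> powr (- 1 / real n)) * m"
proof -
  interpret usc_density h M R by fact
  let ?T = "transpose A"
  let ?B = "cball (0 :: real ^ 'n) 1"
  let ?V = "unit_ball_vol (real n - 1)"
  let ?C = "ennreal (M * (unit_ball_vol (real (DIM(real ^ 'n) - 1)) * R ^ (DIM(real ^ 'n) - 1)))"
  define e where "e = (\<lambda>k. 1 / real (Suc k))"
  have e: "0 < e k" "e \<longlonglongrightarrow> 0" for k
    using LIMSEQ_inverse_real_of_nat by (simp_all add: e_def inverse_eq_divide)
  let ?J = "\<lambda>k x. ennreal (1 / (2 * e k)) * emeasure lborel {y \<in> ?B. \<bar>(A *v x) \<bullet> y\<bar> \<le> e k}"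
  have dT: "det ?T \<noteq> 0" using A by simp
  have inj: "N *v x \<noteq> 0" if "det N \<noteq> 0" "x \<noteq> 0" for N :: "real ^ 'n ^ 'n" and x
    using that by (metis invertible_det_nz invertible_left_inverse matrix_left_invertible_ker)
  have Vn: "real (DIM(real ^ 'n) - 1) = real n - 1"
    using n by (simp add: of_nat_diff)
  have mv [measurable]: "(*v) N \<in> borel_measurable borel" for N :: "real ^ 'n ^ 'n"
    by (intro borel_measurable_continuous_onI matrix_vector_mult_linear_continuous_on)
  have [measurable]: "?B \<in> sets borel" by simp
  have adj: "(A *v x) \<bullet> y = x \<bullet> (?T *v y)" for x y
    by (metis dot_lmul_matrix transpose_matrix_vector inner_commute transpose_transpose)
  note swap = nn_integral_slab_swap[of "(*v) A" "(*v) ?T", OF adj mv]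
  \<comment> \<open>One null set for both variables: at the origin the slab normals
    \<open>A *v x\<close> and \<open>?T *v y\<close> vanish.\<close>
  have AE0: "AE x in (lborel :: (real ^ 'n) measure). x \<noteq> 0"
    by (rule AE_lborel_singleton)
  have "ennreal ?V * (\<integral>\<^sup>+x. h x \<partial>lborel) = (\<integral>\<^sup>+x. h x * ennreal ?V \<partial>lborel)"
    by (simp add: nn_integral_multc mult.commute)
  also have "\<dots> \<le> (\<integral>\<^sup>+x. liminf (\<lambda>k. h x * ?J k x) \<partial>lborel)"
  proof (rule nn_integral_mono_AE, use AE0 in eventually_elim)
    fix x :: "real ^ 'n" assume x: "x \<noteq> 0"
    show "h x * ennreal ?V \<le> liminf (\<lambda>k. h x * ?J k x)"
    proof (cases "h x = 0")
      case False
      \<comment> \<open>Finiteness makes multiplication by \<open>h x\<close> continuous on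
        \<open>ennreal\<close>, so it commutes with the limit inferior.\<close>
      have hx: "h x < top"
        by (rule le_less_trans[OF bound]) (simp add: indicator_def)
      have "ennreal ?V \<le> liminf (\<lambda>k. ?J k x)"
        using supp[OF False] inj[OF A x] e by (intro liminf_ball_slab_ge[of "A *v x" e, unfolded Vn]) auto
      then have "h x * ennreal ?V \<le> h x * liminf (\<lambda>k. ?J k x)"
        by (intro mult_left_mono) auto
      also have "\<dots> = liminf (\<lambda>k. h x * ?J k x)"
        by (rule Liminf_compose_continuous_mono[symmetric])
          (auto intro!: ennreal_continuous_on_cmult hx monoI mult_left_mono continuous_on_id)
      finally show ?thesis .
    qed simp
  qed
  also have "\<dots> \<le> liminf (\<lambda>k. \<integral>\<^sup>+x. h x * ?J k x \<partial>lborel)"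
    using swap(2) by (intro nn_integral_liminf) simp
  also have "\<dots> = liminf (\<lambda>k. \<integral>\<^sup>+y. slab_mean (?T *v y) (e k) * indicator ?B y \<partial>lborel)"
    by (simp only: swap(1))
  \<comment> \<open>The lower estimate from integrating over \<open>y\<close> first meets the upper
    estimate from integrating over \<open>x\<close> first.\<close>
  also have "\<dots> \<le> limsup (\<lambda>k. \<integral>\<^sup>+y. slab_mean (?T *v y) (e k) * indicator ?B y \<partial>lborel)"
    by (rule Liminf_le_Limsup) simp
  also have "\<dots> \<le> (\<integral>\<^sup>+y. limsup (\<lambda>k. slab_mean (?T *v y) (e k) * indicator ?B y) \<partial>lborel)"
  \<comment> \<open>The majorant is the uniform slab bound \<open>?C\<close> times 1 / |A^T y|,
    whose integral over the ball is finite by the layer cake estimate.\<close>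
  proof (rule nn_integral_limsup[where w = "\<lambda>y. ennreal (1 / norm (?T *v y)) * indicator ?B y * ?C"])
    show "(\<lambda>y. slab_mean (?T *v y) (e k) * indicator ?B y) \<in> borel_measurable lborel" for k
      using swap(3) by simp
    show "(\<lambda>y. ennreal (1 / norm (?T *v y)) * indicator ?B y * ?C) \<in> borel_measurable lborel"
      by measurable
    show "AE y in lborel. slab_mean (?T *v y) (e k) * indicator ?B y
        \<le> ennreal (1 / norm (?T *v y)) * indicator ?B y * ?C" for k
      using AE0
    proof eventually_elim
      fix y :: "real ^ 'n" assume "y \<noteq> 0"
      then show "slab_mean (?T *v y) (e k) * indicator ?B y \<le> ennreal (1 / norm (?T *v y)) * indicator ?B y * ?C"
        using slab_mean_le[OF inj[OF dT] e(1)] by (auto simp: indicator_def)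
    qed
    have "(\<integral>\<^sup>+y. ennreal (1 / norm (?T *v y)) * indicator ?B y * ?C \<partial>lborel)
        = (\<integral>\<^sup>+y. ennreal (1 / norm (?T *v y)) * indicator ?B y \<partial>lborel) * ?C"
      by (rule nn_integral_multc) measurable
    also have "\<dots> < \<infinity>"
      using nn_integral_inverse_norm_matrix_le[OF dT n]
      by (auto simp: ennreal_mult_less_top intro: le_less_trans)
    finally show "(\<integral>\<^sup>+y. ennreal (1 / norm (?T *v y)) * indicator ?B y * ?C \<partial>lborel) < \<infinity>" .
  qed
  also have "\<dots> \<le> (\<integral>\<^sup>+y. ennreal (1 / norm (?T *v y)) * indicator ?B y * m \<partial>lborel)"
  proof (rule nn_integral_mono_AE, use AE0 in eventually_elim)
    fix y :: "real ^ 'n" assume y: "y \<noteq> 0"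
    let ?v = "?T *v y"
    have v: "?v \<noteq> 0" by (rule inj[OF dT y])
    have "limsup (\<lambda>k. slab_mean ?v (e k)) \<le> ennreal (1 / norm ?v) * slice (?v /\<^sub>R norm ?v)"
      by (rule limsup_slab_mean_le[OF v e])
    also have "\<dots> \<le> ennreal (1 / norm ?v) * m"
      using v by (intro mult_left_mono m) auto
    finally show "limsup (\<lambda>k. slab_mean ?v (e k) * indicator ?B y) \<le> ennreal (1 / norm ?v) * indicator ?B y * m"
      by (auto simp: indicator_def Limsup_const)
  qed
  also have "\<dots> = (\<integral>\<^sup>+y. ennreal (1 / norm (?T *v y)) * indicator ?B y \<partial>lborel) * m"
    by (rule nn_integral_multc) measurable
  also have "\<dots> \<le> ennreal (real n / (real n - 1) * unit_ball_vol (real n) * \<bar>det A\<bar> powr (- 1 / real n)) * m"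
    using nn_integral_inverse_norm_matrix_le[OF dT n] by (intro mult_right_mono) auto
  finally show ?thesis .
qed

section \<open>The density extended by zero, and the final estimate\<close>

lemma usc_density_body:
  fixes g :: "'a::euclidean_space \<Rightarrow> real"
  assumes L: "compact L" and cont: "continuous_on L g"
  obtains M R where "usc_density (\<lambda>x. ennreal (g x) * indicator L x) M R"
proof -
  obtain R where R: "0 < R" "\<And>x. x \<in> L \<Longrightarrow> norm x \<le> R"
    using compact_imp_bounded[OF L] unfolding bounded_pos by blast
  obtain M where M: "0 < M" "\<And>x. x \<in> L \<Longrightarrow> \<bar>g x\<bar> \<le> M"
    using compact_imp_bounded[OF compact_continuous_image[OF cont L]] unfolding bounded_pos by auto
  have cl: "closed L" by (rule compact_imp_closed[OF L])
  let ?h = "\<lambda>x. ennreal (g x) * indicator L x"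
  show thesis
  proof (rule that[of M R], unfold_locales)
    have "(\<lambda>x. indicator L x *\<^sub>R g x) \<in> borel_measurable borel"
      using cl cont by (intro borel_measurable_continuous_on_indicator) auto
    then have "(\<lambda>x. ennreal (indicator L x *\<^sub>R g x)) \<in> borel_measurable borel"
      by simp
    also have "(\<lambda>x. ennreal (indicator L x *\<^sub>R g x)) = ?h"
      by (auto simp: indicator_def)
    finally show "?h \<in> borel_measurable borel" .
    show "?h x \<le> ennreal M * indicator (cball 0 R) x" for x
      using R(2)[of x] M(2)[of x] by (auto simp: indicator_def intro!: ennreal_leI)
    fix X :: "nat \<Rightarrow> 'a" and x assume X: "X \<longlonglongrightarrow> x"
    show "limsup (\<lambda>k. ?h (X k)) \<le> ?h x"
    proof (cases "x \<in> L")
      case False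
      \<comment> \<open>The complement of \<open>L\<close> is open, so the extended density is
        eventually 0 along the sequence.\<close>
      then have "eventually (\<lambda>k. X k \<in> - L) sequentially"
        using cl by (intro topological_tendstoD[OF X]) auto
      then have "eventually (\<lambda>k. ?h (X k) \<le> 0) sequentially"
        by eventually_elim auto
      then show ?thesis
        by (metis Limsup_bounded order_trans zero_le)
    next
      case True
      \<comment> \<open>Points of the sequence inside \<open>L\<close> obey continuity of
        \<open>g\<close>, points outside contribute 0; either way the value is at most
        \<open>c\<close>. Density of the order then yields the bound by \<open>g x\<close>
        itself.\<close>
      have "eventually (\<lambda>k. ?h (X k) \<le> c) sequentially" if c: "ennreal (g x) < c" for c
      proof -
        obtain d where d: "0 < d" "\<And>y. y \<in> L \<Longrightarrow> dist y x < d \<Longrightarrow> ennreal (g y) < c"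
        proof -
          have "continuous_on L (\<lambda>y. ennreal (g y))"
            by (intro continuous_on_ennreal cont)
          then have "((\<lambda>y. ennreal (g y)) \<longlongrightarrow> ennreal (g x)) (at x within L)"
            using True by (auto simp: continuous_on_def)
          then have "eventually (\<lambda>y. ennreal (g y) < c) (at x within L)"
            using c by (rule order_tendstoD)
          then show thesis
            using that c unfolding eventually_at by (metis dist_commute)
        qed
        have "eventually (\<lambda>k. dist (X k) x < d) sequentially"
          using tendstoD[OF X d(1)] .
        then show ?thesis
        proof eventually_elim
          case (elim k)
          then show ?case
            using d(2)[of "X k"] by (auto simp: indicator_def less_imp_le)
        qed
      qed
      then have "limsup (\<lambda>k. ?h (X k)) \<le> c" if "ennreal (g x) < c" for c
        using that by (intro Limsup_bounded)
      then have "limsup (\<lambda>k. ?h (X k)) \<le> ennreal (g x)"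
        by (rule dense_ge)
      moreover have "?h x = ennreal (g x)"
        using True by simp
      ultimately show ?thesis
        by (simp only:)
    qed
  qed (use M R in auto)
qed

text \<open>The measure \<open>lborel_subspace\<close> is concentrated on the hyperplane, so
  intersecting \<open>L\<close> with it changes nothing under the integral.\<close>

lemma section_mass_eq_slice:
  fixes g :: "'a::euclidean_space \<Rightarrow> real"
  assumes h: "usc_density (\<lambda>x. ennreal (g x) * indicator L x) M R"
    and L: "compact L" and cont: "continuous_on L g" and nonneg: "\<And>x. x \<in> L \<Longrightarrow> 0 \<le> g x"
  shows "section_mass g L \<xi> = enn2real (usc_density.slice (\<lambda>x. ennreal (g x) * indicator L x) \<xi>)"
proof -
  interpret usc_density "\<lambda>x. ennreal (g x) * indicator L x" M R by fact
  obtain B where B: "orthonormal_basis_of (hyperplane_perp \<xi>) B"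
    using orthonormal_basis_of_exists subspace_hyperplane_perp by blast
  let ?H = "hyperplane_perp \<xi>"
  let ?\<mu> = "lborel_subspace ?H"
  have sets: "sets ?\<mu> = sets borel"
    by (simp add: lborel_subspace_eq[OF B])
  have cl: "closed L" by (rule compact_imp_closed[OF L])
  have clH: "closed (L \<inter> ?H)"
    by (intro closed_Int cl closed_Collect_eq continuous_intros)
  have "(\<lambda>x. indicator (L \<inter> ?H) x *\<^sub>R g x) \<in> borel_measurable borel"
    using clH cont by (intro borel_measurable_continuous_on_indicator) (auto intro: continuous_on_subset)
  then have meas: "(\<lambda>x. indicator (L \<inter> ?H) x *\<^sub>R g x) \<in> borel_measurable ?\<mu>"
    using sets by (simp cong: measurable_cong_sets)
  have "section_mass g L \<xi> = enn2real (\<integral>\<^sup>+x. ennreal (indicator (L \<inter> ?H) x *\<^sub>R g x) \<partial>?\<mu>)"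
    unfolding section_mass_def set_lebesgue_integral_def
    by (rule integral_eq_nn_integral[OF meas]) (auto simp: indicator_def nonneg)
  also have "(\<integral>\<^sup>+x. ennreal (indicator (L \<inter> ?H) x *\<^sub>R g x) \<partial>?\<mu>)
      = (\<integral>\<^sup>+f. ennreal (indicator (L \<inter> ?H) (coords_to_vec B f) *\<^sub>R g (coords_to_vec B f)) \<partial>(\<Pi>\<^sub>M b\<in>B. lborel))"
    using meas unfolding lborel_subspace_eq[OF B] by (intro nn_integral_distr) auto
  also have "\<dots> = slice \<xi>"
    unfolding slice_eq_coords[OF B]
    by (intro nn_integral_cong) (auto simp: indicator_def coords_to_vec_perp[OF B])
  finally show ?thesis .
qed


lemma slice_finite:
  assumes "usc_density h M R"
  shows "usc_density.slice h \<xi> < top"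
proof -
  interpret usc_density h M R by fact
  obtain B where B: "orthonormal_basis_of (hyperplane_perp \<xi>) B"
    using orthonormal_basis_of_exists subspace_hyperplane_perp by blast
  show ?thesis
    unfolding slice_eq_coords[OF B]
    by (rule le_less_trans[OF nn_integral_coords_le[OF B]]) auto
qed

text \<open>The inner ellipsoid has volume |B_n| n^(-n/2) / |det A| and lies in \<open>L\<close>;
  taking n-th roots turns n^(-n/2) into the factor sqrt n of the theorem.\<close>

lemma ellipsoid_volume_le:
  fixes L :: "(real ^ 'n) set" and A :: "real ^ 'n ^ 'n"
  assumes n: "n = CARD('n)" and L: "compact L" and A: "det A \<noteq> 0"
    and sub: "\<And>x. norm (A *v x) \<le> 1 / sqrt (real n) \<Longrightarrow> x \<in> L"
  shows "\<bar>det A\<bar> powr (- 1 / real n)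
       \<le> sqrt (real n) * measure lborel L powr (1 / real n) * unit_ball_vol (real n) powr (- 1 / real n)"
proof -
  have n0: "0 < n" using n by simp
  let ?V = "unit_ball_vol (real n)"
  have V: "0 < ?V" by simp
  have "ennreal (?V * (1 / sqrt (real n)) ^ n / \<bar>det A\<bar>) = emeasure lborel {x. norm (A *v x) \<le> 1 / sqrt (real n)}"
    using emeasure_matrix_norm_le[OF A, of "1 / sqrt (real n)"] n by simp
  also have "\<dots> \<le> emeasure lborel L"
    using sub L by (intro emeasure_mono) (auto simp: compact_imp_closed)
  also have "\<dots> = ennreal (measure lborel L)"
    using emeasure_compact_finite[OF L] by (simp add: emeasure_eq_ennreal_measure)
  finally have "?V * (1 / sqrt (real n)) ^ n / \<bar>det A\<bar> \<le> measure lborel L"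
    by simp
  then have "1 / \<bar>det A\<bar> \<le> sqrt (real n) ^ n * measure lborel L / ?V"
    using A n0 by (simp add: field_simps power_divide)
  then have "(1 / \<bar>det A\<bar>) powr (1 / real n) \<le> (sqrt (real n) ^ n * measure lborel L / ?V) powr (1 / real n)"
    by (intro powr_mono2) auto
  also have "\<dots> = (sqrt (real n) ^ n) powr (1 / real n) * measure lborel L powr (1 / real n) / ?V powr (1 / real n)"
    by (simp add: powr_mult powr_divide)
  also have "(sqrt (real n) ^ n) powr (1 / real n) = sqrt (real n)"
    using n0 by (simp add: powr_powr flip: powr_realpow)
  finally show ?thesis
    by (simp add: powr_divide powr_minus_divide)
qed

theorem theorem1:
  fixes L :: "(real ^ 'n) set" and g :: "real ^ 'n \<Rightarrow> real" and n :: nat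
  assumes n_def: "n = CARD('n)" and n_ge_2: "n \<ge> 2"
    and body: "origin_symmetric_convex_body L"
    and cont: "continuous_on L g"
    and nonneg: "\<And>x. x \<in> L \<Longrightarrow> 0 \<le> g x"
    and even: "\<And>x. x \<in> L \<Longrightarrow> g (- x) = g x"
  shows "\<exists>\<xi>\<^sub>0. is_arg_max (section_mass g L) (\<lambda>\<xi>. \<xi> \<in> sphere 0 1) \<xi>\<^sub>0 \<and>
           body_mass g L \<le>
             sqrt (real n) * (real n / (real n - 1)) * ball_ratio n *
             section_mass g L \<xi>\<^sub>0 * measure lborel L powr (1 / real n)"
proof -
  have L: "compact L"
    using body by (simp add: origin_symmetric_convex_body_def)
  define h where "h = (\<lambda>x. ennreal (g x) * indicator L x)"
  obtain M R where h: "usc_density h M R"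
    using usc_density_body[OF L cont] unfolding h_def by blast
  have sm: "section_mass g L \<xi> = enn2real (usc_density.slice h \<xi>)" for \<xi>
    unfolding h_def by (rule section_mass_eq_slice[OF h[unfolded h_def] L cont nonneg])
  obtain \<xi>0 where \<xi>0: "norm \<xi>0 = 1"
    and max: "\<And>\<eta>. norm \<eta> = 1 \<Longrightarrow> usc_density.slice h \<eta> \<le> usc_density.slice h \<xi>0"
    using slice_attains_max[OF h] by blast
  \<comment> \<open>Finiteness of the slices makes \<open>enn2real\<close> monotone on them, so the
    maximiser carries over to real masses.\<close>
  have arg_max: "is_arg_max (section_mass g L) (\<lambda>\<xi>. \<xi> \<in> sphere 0 1) \<xi>0"
    using \<xi>0 by (auto simp: is_arg_max_def sm not_less intro!: enn2real_mono max slice_finite[OF h])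
  let ?m = "section_mass g L \<xi>0" and ?V = "unit_ball_vol (real n)" and ?W = "unit_ball_vol (real n - 1)"
  have m0: "0 \<le> ?m" by (simp add: sm)
  have slice_m: "usc_density.slice h \<xi>0 = ennreal ?m"
    using slice_finite[OF h, of \<xi>0] by (simp add: sm)
  obtain A :: "real ^ 'n ^ 'n" where A: "det A \<noteq> 0" "\<And>x. x \<in> L \<Longrightarrow> norm (A *v x) \<le> 1"
    "\<And>x. norm (A *v x) \<le> 1 / sqrt (real CARD('n)) \<Longrightarrow> x \<in> L"
    by (rule john_ellipsoid[OF body]) blast
  let ?D = "\<bar>det A\<bar> powr (- 1 / real n)"
  have W: "0 < ?W" and V: "0 < ?V"
    using n_ge_2 by simp_all
  have "norm (A *v x) \<le> 1" if "h x \<noteq> 0" for x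
    using that A(2)[of x] by (auto simp: h_def indicator_def split: if_splits)
  then have main: "ennreal ?W * (\<integral>\<^sup>+x. h x \<partial>lborel) \<le> ennreal (real n / (real n - 1) * ?V * ?D) * ennreal ?m"
    using nn_integral_le_slice_bound[OF h n_def n_ge_2 A(1)] max unfolding slice_m by blast
  have "body_mass g L = enn2real (\<integral>\<^sup>+x. ennreal (indicator L x *\<^sub>R g x) \<partial>lborel)"
    unfolding body_mass_def set_lebesgue_integral_def
    using borel_measurable_continuous_on_indicator[OF _ cont] compact_imp_closed[OF L]
    by (intro integral_eq_nn_integral) (auto simp: indicator_def nonneg)
  also have "(\<integral>\<^sup>+x. ennreal (indicator L x *\<^sub>R g x) \<partial>lborel) = (\<integral>\<^sup>+x. h x \<partial>lborel)"
    by (intro nn_integral_cong) (auto simp: h_def indicator_def)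
  finally have bm: "body_mass g L = enn2real (\<integral>\<^sup>+x. h x \<partial>lborel)" .
  have "?W * body_mass g L = enn2real (ennreal ?W * (\<integral>\<^sup>+x. h x \<partial>lborel))"
    using W by (simp add: bm enn2real_mult)
  also have "\<dots> \<le> enn2real (ennreal (real n / (real n - 1) * ?V * ?D) * ennreal ?m)"
    by (intro enn2real_mono main) (simp add: ennreal_mult_less_top)
  also have "\<dots> = real n / (real n - 1) * ?V * ?D * ?m"
    using n_ge_2 V m0 by (simp add: enn2real_mult)
  also have "\<dots> \<le> real n / (real n - 1) * ?V *
      (sqrt (real n) * measure lborel L powr (1 / real n) * ?V powr (- 1 / real n)) * ?m"
    using n_ge_2 V m0 A(1,3) n_def
    by (intro mult_right_mono mult_left_mono ellipsoid_volume_le[OF n_def L]) auto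
  also have "\<dots> = sqrt (real n) * (real n / (real n - 1)) * (?V * ?V powr (- 1 / real n)) * ?m
      * measure lborel L powr (1 / real n)"
    by (simp only: mult_ac)
  \<comment> \<open>The exponent 1 comes from integrating over the unit ball, -1/n from the
    determinant bound; together they give the numerator of \<open>ball_ratio\<close>, and
    \<open>?W\<close> is its denominator.\<close>
  also have "?V * ?V powr (- 1 / real n) = ?V powr ((real n - 1) / real n)"
  proof -
    have "?V powr 1 * ?V powr (- 1 / real n) = ?V powr (1 + (- 1 / real n))"
      by (rule powr_add[symmetric])
    also have "1 + (- 1 / real n) = (real n - 1) / real n"
      using n_ge_2 by (simp add: field_simps)
    finally show ?thesis using V by simp
  qed
  finally have "body_mass g L \<le> sqrt (real n) * (real n / (real n - 1)) * ?V powr ((real n - 1) / real n) * ?m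
      * measure lborel L powr (1 / real n) / ?W"
    using W by (simp only: pos_le_divide_eq mult.commute)
  then have "body_mass g L \<le> sqrt (real n) * (real n / (real n - 1)) * ball_ratio n * ?m
      * measure lborel L powr (1 / real n)"
    by (simp add: ball_ratio_def)
  with arg_max show ?thesis by blast
qed

end
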